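(* Let $n\geq 1$ and let $A$ and $B$ be two $n\times n$ generalized tournament matrices. The following assertions are equivalent: (i) $A$ and $B$ have the same principal minors of orders at most $4$ (i.e. $\det A[X]=\det B[X]$ for every $X\subseteq[n]$ with $1\le |X|\le 4$); (ii) $A$ and $B$ have the same principal minors of every order (i.e. $\det A[X]=\det B[X]$ for every nonempty $X\subseteq [n]$); (iii) there exists a sequence $A_0=A, A_1,\ldots,A_m=B$ of $n\times n$ generalized tournament matrices such that for each $k=0,\ldots,m-1$, $A_{k+1}=\mathrm{Inv}(A_k,X_k)$ where $X_k$ is a clan of $A_k$.
   Context: A generalized tournament matrix of order $n$ is a real $n\times n$ matrix $M=(m_{ij})$ with nonnegative entries satisfying $M+M^{t}=J_n-I_n$, where $J_n$ is the all-ones matrix and $I_n$ the identity matrix (so $m_{ii}=0$ and $m_{ij}=1-m_{ji}\in[0,1]$ for $i\neq j$). Write $[n]=\{1,\ldots,n\}$. For nonempty $X\subseteq[n]$, $M[X]$ is the principal submatrix with rows and columns indexed by $X$. A clan of $M$ is a subset $X\subseteq[n]$ such that for all $i,j\in X$ and $k\in[n]\setminus X$, $m_{ik}=m_{jk}$ and $m_{ki}=m_{kj}$. For $Y\subseteq[n]$, $\mathrm{Inv}(M,Y)$ denotes the matrix obtained from $M$ by replacing the entry $m_{ij}$ by $m_{ji}$ for all $i,j\in Y$. *)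

theory Defs
  imports "Jordan_Normal_Form.Determinant" "Jordan_Normal_Form.DL_Submatrix"
begin

text \<open>Indices are 0-based: the index set [n] = {1..n} of the paper is rendered as {..<n}.\<close>

definition gen_tournament :: "nat \<Rightarrow> real mat \<Rightarrow> bool" where
  "gen_tournament n M \<longleftrightarrow>
     M \<in> carrier_mat n n \<and>
     (\<forall>i<n. \<forall>j<n. M $$ (i,j) \<ge> 0) \<and>
     M + transpose_mat M = mat n n (\<lambda>_. 1) - 1\<^sub>m n"

definition principal_submatrix :: "'a mat \<Rightarrow> nat set \<Rightarrow> 'a mat" where
  "principal_submatrix M X = submatrix M X X"

definition is_clan :: "nat \<Rightarrow> 'a mat \<Rightarrow> nat set \<Rightarrow> bool" where
  "is_clan n M X \<longleftrightarrow> X \<subseteq> {..<n} \<and>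
     (\<forall>i\<in>X. \<forall>j\<in>X. \<forall>k\<in>{..<n} - X.
        M $$ (i,k) = M $$ (j,k) \<and> M $$ (k,i) = M $$ (k,j))"

definition Inv :: "'a mat \<Rightarrow> nat set \<Rightarrow> 'a mat" where
  "Inv M Y = mat (dim_row M) (dim_col M)
     (\<lambda>(i,j). if i \<in> Y \<and> j \<in> Y then M $$ (j,i) else M $$ (i,j))"

end

theory Submission
  imports Defs "Jordan_Normal_Form.Char_Poly"
begin

text \<open>
  A clan \<open>X\<close> of \<open>M\<close> makes the off-diagonal blocks between \<open>X\<close> and its complement rank one, of the
  form \<open>1 w\<^sup>T\<close> and \<open>z 1\<^sup>T\<close>; by Schur complements the determinant depends on the block
  \<open>P = M[X]\<close> only through \<open>det P\<close> and \<open>1\<^sup>T (adj P) 1\<close>, which are invariant under transposition.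
  Hence inverting a clan preserves all principal minors.

  Conversely let \<open>s\<close> and \<open>t\<close> be the skew parts of two matrices with equal minors of order at most 4.
  They agree up to signs, so every pair with nonzero entry is either kept or reversed. If in a
  triangle exactly one pair is reversed, then its two ends look the same from the third vertex.
  Consequently the components of the graph of reversed pairs are clans, and so are those of the
  graph of kept pairs. If both graphs are connected, then the vertex set has a cut: it splits into
  two nonempty parts with a constant nonzero entry from one to the other. This goes by induction,
  deleting a vertex: if a deletion disconnects one of the graphs, a cut is found directly (this is
  where the minors of order 4 enter); otherwise all vertex-deleted subsets have cuts, with the same
  constant up to sign, and Moon's theorem on strong tournaments gives a cut of the whole set.
  So a matrix without nontrivial clans can only be kept or transposed as a whole.
  If there are nontrivial clans, take a maximal one \<open>X\<close> over all matrices reachable by inversions.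
  By induction one may assume that the two matrices agree on \<open>X\<close> and on the quotient by \<open>X\<close>.
  Maximality then forces the set of reversed pairs to be of the form \<open>Z \<times> (V - X)\<close> with
  \<open>Z \<subseteq> X\<close>, and three further clan inversions remove it.
\<close>

section \<open>Skew functions with equal invariants\<close>

definition skew :: "('a \<Rightarrow> 'a \<Rightarrow> real) \<Rightarrow> bool" where
  "skew s \<longleftrightarrow> (\<forall>i j. s j i = - s i j)"

text \<open>One equation suffices: for skew \<open>s\<close> the equality of \<open>s k i\<close>
  and \<open>s k j\<close> follows.\<close>

definition sclan :: "'a set \<Rightarrow> ('a \<Rightarrow> 'a \<Rightarrow> real) \<Rightarrow> 'a set \<Rightarrow> bool" where
  "sclan V s X \<longleftrightarrow> X \<subseteq> V \<and> (\<forall>i\<in>X. \<forall>j\<in>X. \<forall>k\<in>V - X. s i k = s j k)"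

definition flip :: "'a set \<Rightarrow> ('a \<Rightarrow> 'a \<Rightarrow> real) \<Rightarrow> 'a \<Rightarrow> 'a \<Rightarrow> real" where
  "flip X s = (\<lambda>i j. if i \<in> X \<and> j \<in> X then s j i else s i j)"

text \<open>The Pfaffian of the 4 by 4 skew matrix on \<open>i\<close>, \<open>j\<close>,
  \<open>k\<close>, \<open>l\<close>; for skew \<open>s\<close> it vanishes when two indices
  coincide.\<close>

definition pfaff :: "('a \<Rightarrow> 'a \<Rightarrow> real) \<Rightarrow> 'a \<Rightarrow> 'a \<Rightarrow> 'a \<Rightarrow> 'a \<Rightarrow> real" where
  "pfaff s i j k l = s i j * s k l - s i k * s j l + s i l * s j k"

text \<open>Equality of the principal minors of orders 2, 3 and 4, expressed in the skew part: a minor of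
  order 3 is a polynomial in squared entries and the squared Pfaffian of the skew matrix bordered
  by ones, one of order 4 moreover involves the squared Pfaffian of the quadruple.\<close>

definition minors_agree :: "'a set \<Rightarrow> ('a \<Rightarrow> 'a \<Rightarrow> real) \<Rightarrow> ('a \<Rightarrow> 'a \<Rightarrow> real) \<Rightarrow> bool" where
  "minors_agree V s t \<longleftrightarrow>
     (\<forall>i\<in>V. \<forall>j\<in>V. (s i j)\<^sup>2 = (t i j)\<^sup>2) \<and>
     (\<forall>i\<in>V. \<forall>j\<in>V. \<forall>k\<in>V. (s i j + s j k + s k i)\<^sup>2 = (t i j + t j k + t k i)\<^sup>2) \<and>
     (\<forall>i\<in>V. \<forall>j\<in>V. \<forall>k\<in>V. \<forall>l\<in>V. (pfaff s i j k l)\<^sup>2 = (pfaff t i j k l)\<^sup>2)"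

text \<open>Replacing \<open>t\<close> by \<open>neg t\<close> exchanges reversed and kept pairs, so
  each lemma on reversed pairs has a counterpart for kept pairs.\<close>

abbreviation (input) neg :: "('a \<Rightarrow> 'a \<Rightarrow> real) \<Rightarrow> 'a \<Rightarrow> 'a \<Rightarrow> real" where
  "neg t \<equiv> \<lambda>i j. - t i j"

text \<open>\<open>dif s t\<close> holds for the pairs that are reversed between \<open>s\<close> and \<open>t\<close>, and \<open>dif s (neg t)\<close> for
  those that are kept; a pair with entry 0 is neither.\<close>

definition dif :: "('a \<Rightarrow> 'a \<Rightarrow> real) \<Rightarrow> ('a \<Rightarrow> 'a \<Rightarrow> real) \<Rightarrow> 'a \<Rightarrow> 'a \<Rightarrow> bool" where
  "dif s t i j \<longleftrightarrow> t i j \<noteq> s i j"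

text \<open>Connectivity is phrased by edges leaving proper parts, which avoids paths and matches
  the form of \<open>has_cut\<close>.\<close>

definition conn :: "('a \<Rightarrow> 'a \<Rightarrow> bool) \<Rightarrow> 'a set \<Rightarrow> bool" where
  "conn G V \<longleftrightarrow> (\<forall>P. P \<subseteq> V \<and> P \<noteq> {} \<and> P \<noteq> V \<longrightarrow> (\<exists>p\<in>P. \<exists>q\<in>V - P. G p q))"

text \<open>For skew \<open>s\<close> both sides of a cut are clans; this is how cuts contradict the
  absence of nontrivial clans.\<close>

definition has_cut :: "'a set \<Rightarrow> ('a \<Rightarrow> 'a \<Rightarrow> real) \<Rightarrow> real \<Rightarrow> bool" where
  "has_cut V s a \<longleftrightarrow> (\<exists>P. P \<subseteq> V \<and> P \<noteq> {} \<and> P \<noteq> V \<and> (\<forall>p\<in>P. \<forall>q\<in>V - P. s p q = a))"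

section \<open>Elementary properties of skew functions and their minor invariants\<close>

lemma skewD: "skew s \<Longrightarrow> s j i = - s i j"
  unfolding skew_def by blast

lemma skew_self: "skew s \<Longrightarrow> s i i = 0"
  using skewD[of s i i] by linarith

lemma skew_neg: "skew t \<Longrightarrow> skew (neg t)"
  unfolding skew_def by metis

lemma skew_flip: "skew s \<Longrightarrow> skew (flip X s)"
  unfolding skew_def flip_def by (smt (verit))

lemma minors_agree_sym: "minors_agree V s t \<Longrightarrow> minors_agree V t s"
  by (simp add: minors_agree_def)

lemma minors_agree_trans: "minors_agree V s t \<Longrightarrow> minors_agree V t u \<Longrightarrow> minors_agree V s u"
  by (simp add: minors_agree_def)

lemma minors_agree_subset: "minors_agree V s t \<Longrightarrow> W \<subseteq> V \<Longrightarrow> minors_agree W s t"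
  unfolding minors_agree_def by blast

lemma minors_agree_neg:
  assumes "minors_agree V s t" shows "minors_agree V s (neg t)"
proof -
  have "(- x + - y + - z)\<^sup>2 = (x + y + z)\<^sup>2" for x y z :: real
    by (simp add: power2_eq_square algebra_simps)
  moreover have "pfaff (neg t) i j k l = pfaff t i j k l" for i j k l
    by (simp add: pfaff_def)
  ultimately have "minors_agree V t (neg t)" unfolding minors_agree_def by (simp only: power2_minus simp_thms) blast
  then show ?thesis using assms minors_agree_trans by blast
qed

lemma minors_agree_cong: "(\<And>i j. i \<in> V \<Longrightarrow> j \<in> V \<Longrightarrow> s i j = s' i j) \<Longrightarrow> minors_agree V s s'"
  by (simp add: minors_agree_def pfaff_def)

lemma flip_sq: "skew s \<Longrightarrow> (s i j)\<^sup>2 = (flip X s i j)\<^sup>2"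
  unfolding flip_def by (auto simp: skewD[of s i j])

text \<open>If exactly two indices lie in \<open>X\<close>, the clan equations cancel all terms but
  the one containing their common entry, and the flip changes its sign. If exactly three of four lie
  in \<open>X\<close>, the Pfaffian is an outer entry times a cyclic sum inside \<open>X\<close>,
  which changes sign. The other cases are immediate.\<close>

lemma minors_agree_flip:
  assumes sk: "skew s" and cl: "sclan V s X"
  shows "minors_agree V s (flip X s)"
proof -
  have same: "s i k = s j k" if "i \<in> X" "j \<in> X" "k \<in> V" "k \<notin> X" for i j k
    using cl that unfolding sclan_def by blast
  have fl: "flip X s i j = (if i \<in> X \<and> j \<in> X then - s i j else s i j)" for i j
    unfolding flip_def using skewD[OF sk, of j i] by presburger
  have c3: "(s i j + s j k + s k i)\<^sup>2 = (flip X s i j + flip X s j k + flip X s k i)\<^sup>2"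
    if V: "i \<in> V" "j \<in> V" "k \<in> V" for i j k
  proof -
    define a b d where "a = s i j" and "b = s i k" and "d = s j k"
    have n: "s k i = - b" "s j i = - a" "s k j = - d"
      unfolding a_def b_def d_def by (rule skewD[OF sk])+
    have e: "i \<in> X \<and> j \<in> X \<and> k \<notin> X \<longrightarrow> b = d" "i \<in> X \<and> k \<in> X \<and> j \<notin> X \<longrightarrow> a = - d"
      "j \<in> X \<and> k \<in> X \<and> i \<notin> X \<longrightarrow> a = b"
      using same[of i j k] same[of i k j] same[of j k i] V unfolding n a_def[symmetric] b_def[symmetric] d_def[symmetric] by linarith+
    show ?thesis using e unfolding fl n a_def[symmetric] d_def[symmetric]
      by (cases "i \<in> X"; cases "j \<in> X"; cases "k \<in> X"; simp add: power2_eq_square algebra_simps)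
  qed
  have c4: "(pfaff s i j k l)\<^sup>2 = (pfaff (flip X s) i j k l)\<^sup>2"
    if V: "i \<in> V" "j \<in> V" "k \<in> V" "l \<in> V" for i j k l
  proof -
    define a b c d e f where "a = s i j" and "b = s i k" and "c = s i l"
      and "d = s j k" and "e = s j l" and "f = s k l"
    note df = a_def b_def c_def d_def e_def f_def
    have n: "s j i = - a" "s k i = - b" "s l i = - c" "s k j = - d" "s l j = - e" "s l k = - f"
      unfolding df by (rule skewD[OF sk])+
    note nd = n df[symmetric]
    have q0: "i \<in> X \<and> j \<in> X \<and> k \<notin> X \<longrightarrow> b = d"
      using same[of i j k] V unfolding nd by auto
    have q1: "i \<in> X \<and> k \<in> X \<and> j \<notin> X \<longrightarrow> a = - d"
      using same[of i k j] V unfolding nd by auto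
    have q2: "j \<in> X \<and> k \<in> X \<and> i \<notin> X \<longrightarrow> a = b"
      using same[of j k i] V unfolding nd by auto
    have q3: "i \<in> X \<and> j \<in> X \<and> l \<notin> X \<longrightarrow> c = e"
      using same[of i j l] V unfolding nd by auto
    have q4: "i \<in> X \<and> l \<in> X \<and> j \<notin> X \<longrightarrow> a = - e"
      using same[of i l j] V unfolding nd by auto
    have q5: "j \<in> X \<and> l \<in> X \<and> i \<notin> X \<longrightarrow> a = c"
      using same[of j l i] V unfolding nd by auto
    have q6: "i \<in> X \<and> k \<in> X \<and> l \<notin> X \<longrightarrow> c = f"
      using same[of i k l] V unfolding nd by auto
    have q7: "i \<in> X \<and> l \<in> X \<and> k \<notin> X \<longrightarrow> b = - f"
      using same[of i l k] V unfolding nd by auto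
    have q8: "k \<in> X \<and> l \<in> X \<and> i \<notin> X \<longrightarrow> b = c"
      using same[of k l i] V unfolding nd by auto
    have q9: "j \<in> X \<and> k \<in> X \<and> l \<notin> X \<longrightarrow> e = f"
      using same[of j k l] V unfolding nd by auto
    have q10: "j \<in> X \<and> l \<in> X \<and> k \<notin> X \<longrightarrow> d = - f"
      using same[of j l k] V unfolding nd by auto
    have q11: "k \<in> X \<and> l \<in> X \<and> j \<notin> X \<longrightarrow> d = e"
      using same[of k l j] V unfolding nd by auto
    note q = q0 q1 q2 q3 q4 q5 q6 q7 q8 q9 q10 q11
    show ?thesis using q unfolding pfaff_def fl df[symmetric]
      by (cases "i \<in> X"; cases "j \<in> X"; cases "k \<in> X"; cases "l \<in> X";
          simp add: power2_eq_square algebra_simps)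
  qed
  show ?thesis unfolding minors_agree_def using c3 c4 flip_sq[OF sk] by blast
qed

section \<open>Reversed and kept pairs in a triangle\<close>

lemma minors_agree_alt:
  assumes "minors_agree V s t" "i \<in> V" "j \<in> V"
  shows "t i j = s i j \<or> t i j = - s i j"
  using assms unfolding minors_agree_def by (metis power2_eq_iff)

lemma dif_sym: "skew s \<Longrightarrow> skew t \<Longrightarrow> dif s t i j \<Longrightarrow> dif s t j i"
  unfolding dif_def by (auto simp: skewD[of s i j] skewD[of t i j])

lemma dif_nonzero:
  assumes "minors_agree V s t" "i \<in> V" "j \<in> V" "dif s t i j" shows "s i j \<noteq> 0" "t i j = - s i j" "\<not> dif s (neg t) i j"
  using minors_agree_alt[OF assms(1-3)] assms(4) unfolding dif_def by auto

lemma dif_cases: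
  assumes "minors_agree V s t" "i \<in> V" "j \<in> V" "s i j \<noteq> 0" shows "dif s t i j \<or> dif s (neg t) i j"
  using minors_agree_alt[OF assms(1-3)] assms(4) unfolding dif_def by auto

text \<open>With \<open>x = s i j\<close> and \<open>y = s j k - s i k\<close>, equality of the
  cyclic sums up to sign reads \<open>(x + y)\<^sup>2 = (y - x)\<^sup>2\<close>, so
  \<open>x * y = 0\<close>, while \<open>x\<close> is nonzero because its pair is reversed.\<close>

lemma triangle:
  assumes "skew s" "skew t" "minors_agree V s t" "i \<in> V" "j \<in> V" "k \<in> V"
    and "dif s t i j" "\<not> dif s t i k" "\<not> dif s t j k"
  shows "s i k = s j k"
proof -
  have "(s i j + s j k + s k i)\<^sup>2 = (t i j + t j k + t k i)\<^sup>2" using assms unfolding minors_agree_def by blast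
  moreover have "t i j = - s i j" "s i j \<noteq> 0" using dif_nonzero[OF assms(3,4,5,7)] by auto
  moreover have "t j k = s j k" "t k i = - s i k" "s k i = - s i k"
    using assms(8,9) skewD[OF assms(1), of k i] skewD[OF assms(2), of k i] unfolding dif_def by auto
  ultimately have "(s i j + (s j k - s i k))\<^sup>2 = (- s i j + (s j k - s i k))\<^sup>2" by (simp add: algebra_simps)
  then have "s i j * (s j k - s i k) = 0" by (simp add: power2_eq_square algebra_simps)
  then show ?thesis using \<open>s i j \<noteq> 0\<close> by simp
qed

text \<open>A zero pair counts as not reversed, so \<open>triangle\<close> would equate the nonzero
  kept entry \<open>s i k\<close> with 0.\<close>

lemma no_rainbow:
  assumes "skew s" "skew t" "minors_agree V s t" "i \<in> V" "j \<in> V" "k \<in> V"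
    and "dif s t i j" "dif s (neg t) i k"
  shows "s j k \<noteq> 0"
proof
  assume 0: "s j k = 0"
  have "\<not> dif s t j k" using dif_nonzero(1)[OF assms(3,5,6)] 0 by blast
  moreover have "\<not> dif s t i k" using dif_nonzero(3)[OF assms(3,4,6)] assms(8) by blast
  ultimately have "s i k = s j k" using triangle[OF assms(1-6,7)] by blast
  then show False using 0 dif_nonzero(1)[OF minors_agree_neg[OF assms(3)] assms(4,6,8)] by simp
qed

section \<open>Connected sets and components\<close>

lemma conn_singleton: "conn G {x}"
  unfolding conn_def by auto

lemma conn_insert:
  assumes "conn G S" "s \<in> S" "G s x" "G x s"
  shows "conn G (insert x S)"
  unfolding conn_def
proof (intro allI impI, elim conjE)
  fix P assume P: "P \<subseteq> insert x S" "P \<noteq> {}" "P \<noteq> insert x S"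
  show "\<exists>p\<in>P. \<exists>q\<in>insert x S - P. G p q"
  proof (cases "P \<inter> S = {} \<or> P \<inter> S = S")
    case True
    then have "(x \<in> P \<and> s \<notin> P) \<or> (x \<notin> P \<and> s \<in> P)" using P assms(2) by blast
    then show ?thesis using assms(2-4) by blast
  next
    case False
    then have "\<exists>p\<in>P \<inter> S. \<exists>q\<in>S - P \<inter> S. G p q" using assms(1) unfolding conn_def by blast
    then show ?thesis by blast
  qed
qed

text \<open>A maximal connected set containing \<open>x\<close> works, since the end of an edge
  leaving it could be added.\<close>

lemma component_exists:
  assumes "finite V" "x \<in> V" and sym: "\<And>i j. G i j \<Longrightarrow> G j i"
  obtains C where "x \<in> C" "C \<subseteq> V" "conn G C" "\<forall>c\<in>C. \<forall>y\<in>V - C. \<not> G c y"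
proof -
  let ?F = "{C. x \<in> C \<and> C \<subseteq> V \<and> conn G C}"
  have "finite ?F" using assms(1) by (auto intro: finite_subset[of _ "Pow V"])
  moreover have "{x} \<in> ?F" using assms(2) conn_singleton by auto
  ultimately obtain C where C: "C \<in> ?F" "\<And>C'. C' \<in> ?F \<Longrightarrow> C \<subseteq> C' \<Longrightarrow> C' = C"
    using finite_has_maximal[of ?F] by (metis (no_types, lifting) empty_iff)
  have "\<not> G c y" if "c \<in> C" "y \<in> V - C" for c y
  proof
    assume "G c y"
    then have "conn G (insert y C)" using conn_insert[of G C c y] sym that C(1) by blast
    then show False using C that by blast
  qed
  then show ?thesis using that C(1) by blast
qed

lemma conn_const:
  assumes "conn G C" and "\<And>p q. p \<in> C \<Longrightarrow> q \<in> C \<Longrightarrow> G p q \<Longrightarrow> f p = f q"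
    and "x \<in> C" "y \<in> C"
  shows "f x = f y"
proof (rule ccontr)
  assume n: "f x \<noteq> f y"
  let ?P = "{p \<in> C. f p = f x}"
  have "?P \<subseteq> C" "?P \<noteq> {}" "?P \<noteq> C" using assms(3,4) n by (blast, blast, force)
  then obtain p q where "p \<in> ?P" "q \<in> C - ?P" "G p q" using assms(1) unfolding conn_def by meson
  then show False using assms(2)[of p q] by auto
qed

text \<open>By \<open>triangle\<close> the two ends of every reversed pair in \<open>C\<close> look
  the same from \<open>k\<close>, and connectivity spreads this over \<open>C\<close>.\<close>

lemma component_const:
  assumes "skew s" "skew t" "minors_agree V s t" "C \<subseteq> V" "conn (dif s t) C"
    and "k \<in> V" "\<And>c. c \<in> C \<Longrightarrow> \<not> dif s t c k" "x \<in> C" "y \<in> C"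
  shows "s x k = s y k"
  using conn_const[of "dif s t" C "\<lambda>c. s c k", OF assms(5) _ assms(8,9)]
    triangle[OF assms(1-3)] assms(4,6,7) by blast

section \<open>Cuts\<close>

lemma connD:
  assumes "conn G V" "P \<subseteq> V" "P \<noteq> {}" "P \<noteq> V"
  obtains p q where "p \<in> P" "q \<in> V - P" "G p q"
  using assms unfolding conn_def by blast

lemma conn_neighbour:
  assumes "conn G V" "k \<in> V" "V - {k} \<noteq> {}"
  obtains q where "q \<in> V - {k}" "G k q"
  using connD[OF assms(1), of "{k}"] assms(2,3) by auto

lemma has_cutI:
  assumes "P \<subseteq> V" "P \<noteq> {}" "P \<noteq> V" "\<And>p q. p \<in> P \<Longrightarrow> q \<in> V - P \<Longrightarrow> s p q = a"
  shows "has_cut V s a"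
  using assms unfolding has_cut_def by blast

lemma has_cut_uminus:
  assumes "skew s" "has_cut V s a"
  shows "has_cut V s (- a)"
proof -
  obtain P where P: "P \<subseteq> V" "P \<noteq> {}" "P \<noteq> V" "\<forall>p\<in>P. \<forall>q\<in>V - P. s p q = a"
    using assms(2) unfolding has_cut_def by blast
  show ?thesis
  proof (rule has_cutI[of "V - P"])
    fix p q assume "p \<in> V - P" "q \<in> V - (V - P)"
    then show "s p q = - a" using P(4) skewD[OF assms(1), of p q] by auto
  qed (use P in auto)
qed

text \<open>Read \<open>s u v \<noteq> a\<close> as an arc from \<open>u\<close> to
  \<open>v\<close>. A vertex with an arc from a strong set and an arc into it can be added to that
  set.\<close>

lemma cutless_insert:
  assumes "\<not> has_cut S s a" "x \<notin> S" "u \<in> S" "v \<in> S" "s u x \<noteq> a" "s x v \<noteq> a"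
  shows "\<not> has_cut (insert x S) s a"
proof
  assume "has_cut (insert x S) s a"
  then obtain P where P: "P \<subseteq> insert x S" "P \<noteq> {}" "P \<noteq> insert x S"
      "\<forall>p\<in>P. \<forall>q\<in>insert x S - P. s p q = a"
    unfolding has_cut_def by blast
  consider "P \<inter> S = {}" | "P \<inter> S = S" | "P \<inter> S \<noteq> {}" "P \<inter> S \<noteq> S" by blast
  then show False
  proof cases
    case 1
    then have "P = {x}" using P by blast
    then show False using P(4) assms(2,4,6) by blast
  next
    case 2
    then have "x \<notin> P" using P by blast
    then show False using 2 P(4) assms(3,5) by blast
  next
    case 3
    then have "has_cut S s a" using P(4) by (intro has_cutI[of "P \<inter> S"]) auto
    then show False using assms(1) by simp
  qed
qed

text \<open>There are arcs from all of \<open>S\<close> to \<open>p\<close>, from \<open>p\<close>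
  to \<open>q\<close>, and from \<open>q\<close> to all of \<open>S\<close>. Each element of
  \<open>S\<close> thus closes a cycle through \<open>p\<close> and \<open>q\<close>, whatever the
  arcs inside \<open>S\<close>.\<close>

lemma cutless_insert2:
  assumes "S \<noteq> {}" "s p q \<noteq> a" "\<And>u. u \<in> S \<Longrightarrow> s u p \<noteq> a" "\<And>u. u \<in> S \<Longrightarrow> s q u \<noteq> a"
  shows "\<not> has_cut (insert p (insert q S)) s a"
proof
  let ?W = "insert p (insert q S)"
  assume "has_cut ?W s a"
  then obtain P where P: "P \<subseteq> ?W" "P \<noteq> {}" "P \<noteq> ?W" "\<forall>x\<in>P. \<forall>y\<in>?W - P. s x y = a"
    unfolding has_cut_def by blast
  show False
  proof (cases "p \<in> P")
    case True
    then have "q \<in> P" using P(4) assms(2) by blast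
    then have "S \<subseteq> P" using P(4) assms(4) by blast
    then show False using \<open>q \<in> P\<close> True P by blast
  next
    case False
    then have S: "S \<inter> P = {}" using P(4) assms(3) by blast
    then have "P = {q}" using P False by blast
    then show False using S assms(1,4) P(4) by blast
  qed
qed

text \<open>The pairs with \<open>s p q \<noteq> a\<close> form a semicomplete digraph, which is strongly connected
  iff there is no cut; so this is Moon's theorem that a strong tournament on at least four
  vertices has a vertex whose deletion leaves it strong.\<close>

lemma cutless_delete_vertex:
  assumes "finite V" "card V \<ge> 4" "skew s" "a \<noteq> 0" "\<not> has_cut V s a"
  shows "\<exists>k\<in>V. \<not> has_cut (V - {k}) s a"
proof -
  let ?F = "{S. S \<subseteq> V \<and> S \<noteq> V \<and> S \<noteq> {} \<and> \<not> has_cut S s a}"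
  have fF: "finite ?F" using assms(1) by (auto intro: finite_subset[of _ "Pow V"])
  obtain v where v: "v \<in> V" using assms(2) by fastforce
  have "\<not> has_cut {v} s a" unfolding has_cut_def by blast
  moreover have "V \<noteq> {v}" using assms(2) by auto
  ultimately have "{v} \<in> ?F" using v by auto
  then obtain S where S: "S \<in> ?F" "\<And>T. T \<in> ?F \<Longrightarrow> S \<subseteq> T \<Longrightarrow> T = S"
    using finite_has_maximal[OF fF] by (metis (no_types, lifting) empty_iff)
  have fS: "finite S" using S(1) assms(1) finite_subset by blast
  have full: "T = V" if "T \<subseteq> V" "S \<subset> T" "\<not> has_cut T s a" for T
    using that S by blast
  show ?thesis
  proof (cases "\<exists>x\<in>V - S. (\<exists>u\<in>S. s u x \<noteq> a) \<and> (\<exists>w\<in>S. s x w \<noteq> a)")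
    case True
    then obtain x u w where x: "x \<in> V" "x \<notin> S" "u \<in> S" "s u x \<noteq> a" "w \<in> S" "s x w \<noteq> a" by blast
    then have "\<not> has_cut (insert x S) s a" using cutless_insert[of S s a x u w] S(1) by blast
    then have "insert x S = V" using full[of "insert x S"] S(1) x by blast
    then have "V - {x} = S" using x by blast
    then show ?thesis using S(1) x(1) by blast
  next
    case False
    \<comment> \<open>By maximality of \<open>S\<close>, no outside vertex has both an arc from
      \<open>S\<close> and an arc into \<open>S\<close>. Those in \<open>P\<close> have no arc into
      \<open>S\<close>, those in \<open>Q\<close> none from it; as \<open>a \<noteq> 0\<close>, all
      opposite arcs are then present. An arc from \<open>P\<close> to \<open>Q\<close> must exist,
      or \<open>V\<close> would have a cut.\<close>
    define P where "P = {x \<in> V - S. \<forall>u\<in>S. s x u = a}"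
    define Q where "Q = {x \<in> V - S. \<forall>u\<in>S. s u x = a}"
    have PQ: "V = P \<union> Q \<union> S" using False S(1) unfolding P_def Q_def by blast
    have "\<exists>p\<in>P. \<exists>q\<in>Q. s p q \<noteq> a"
    proof (rule ccontr)
      assume n: "\<not> ?thesis"
      have "has_cut V s a"
      proof (cases "P = {}")
        case True
        then have "V - S \<subseteq> Q" using PQ by blast
        then show ?thesis using S(1) by (intro has_cutI[of S]) (auto simp: Q_def)
      next
        case False
        have "S \<inter> P = {}" "P \<subseteq> V" unfolding P_def by auto
        moreover have "s p q = a" if "p \<in> P" "q \<in> V - P" for p q
        proof -
          have "q \<in> Q \<or> q \<in> S" using that PQ by blast
          then show ?thesis using n that(1) unfolding P_def by blast
        qed
        ultimately show ?thesis using has_cutI[of P V s a] False S(1) by blast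
      qed
      then show False using assms(5) by simp
    qed
    then obtain p q where pq: "p \<in> P" "q \<in> Q" "s p q \<noteq> a" by blast
    have opp: "s j i \<noteq> a" if "s i j = a" for i j using skewD[OF assms(3), of j i] that assms(4) by simp
    have "p \<noteq> q" using pq opp S(1) unfolding P_def Q_def by blast
    have nc: "\<not> has_cut (insert p (insert q T)) s a" if "T \<subseteq> S" "T \<noteq> {}" for T
      using cutless_insert2[of T s p q a] that pq opp unfolding P_def Q_def by blast
    \<comment> \<open>Maximality makes \<open>p\<close>, \<open>q\<close> and \<open>S\<close>
      exhaust \<open>V\<close>. Since \<open>nc\<close> allows any nonempty part of
      \<open>S\<close>, a vertex of \<open>S\<close> can then be deleted.\<close>
    have "insert p (insert q S) = V"
      using full[of "insert p (insert q S)"] nc[of S] S(1) pq unfolding P_def Q_def by blast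
    then have V: "V = insert p (insert q S)" by simp
    have pS: "p \<notin> S" "q \<notin> S" using pq unfolding P_def Q_def by auto
    have "card S \<ge> 2" using assms(2) V fS pS \<open>p \<noteq> q\<close> by simp
    moreover obtain k where k: "k \<in> S" using S(1) by blast
    ultimately have "card (S - {k}) \<ge> 1" using fS by simp
    then have "S - {k} \<noteq> {}" by (metis card.empty not_one_le_zero)
    then have "\<not> has_cut (insert p (insert q (S - {k}))) s a" using nc[of "S - {k}"] by auto
    moreover have "insert p (insert q (S - {k})) = V - {k}" unfolding V using pS k by auto
    moreover have "k \<in> V" using k V by blast
    ultimately show ?thesis by metis
  qed
qed

text \<open>Records the modulus of the constant of a cut in a way that survives deleting a vertex.\<close>

definition has_abs_cut :: "'a set \<Rightarrow> ('a \<Rightarrow> 'a \<Rightarrow> real) \<Rightarrow> real \<Rightarrow> bool" where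
  "has_abs_cut V s a \<longleftrightarrow>
     (\<exists>P. P \<subseteq> V \<and> P \<noteq> {} \<and> P \<noteq> V \<and> (\<forall>p\<in>P. \<forall>q\<in>V - P. \<bar>s p q\<bar> = a))"

text \<open>Some pair is separated by both bipartitions, and its entry has both moduli.\<close>

lemma has_abs_cut_unique:
  assumes "skew s" "has_abs_cut V s a" "has_abs_cut V s b"
  shows "a = b"
proof -
  obtain P where P: "P \<subseteq> V" "P \<noteq> {}" "P \<noteq> V" "\<forall>p\<in>P. \<forall>q\<in>V - P. \<bar>s p q\<bar> = a"
    using assms(2) unfolding has_abs_cut_def by blast
  obtain R where R: "R \<subseteq> V" "R \<noteq> {}" "R \<noteq> V" "\<forall>p\<in>R. \<forall>q\<in>V - R. \<bar>s p q\<bar> = b"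
    using assms(3) unfolding has_abs_cut_def by blast
  have ab: "\<bar>s p q\<bar> = \<bar>s q p\<bar>" for p q using skewD[OF assms(1), of p q] by simp
  have "(\<exists>p\<in>P \<inter> R. \<exists>q\<in>V - P - R. True) \<or> (\<exists>p\<in>P - R. \<exists>q\<in>R - P. True)"
    using P(1-3) R(1-3) by blast
  then show ?thesis
  proof
    assume "\<exists>p\<in>P \<inter> R. \<exists>q\<in>V - P - R. True"
    then obtain p q where "p \<in> P" "p \<in> R" "q \<in> V - P" "q \<in> V - R" by blast
    then show ?thesis using P(4) R(4) by metis
  next
    assume "\<exists>p\<in>P - R. \<exists>q\<in>R - P. True"
    then obtain p q where "p \<in> P" "p \<in> V - R" "q \<in> V - P" "q \<in> R" using P(1) R(1) by blast
    then show ?thesis using P(4) R(4) ab by metis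
  qed
qed

text \<open>If \<open>l\<close> is not a whole side, the cut restricts. Otherwise all entries at
  \<open>l\<close> have modulus \<open>\<bar>a\<bar>\<close>, and the vertices reversed and those
  kept towards \<open>l\<close> form the two sides of a new cut: \<open>triangle\<close> gives each
  crossing pair the modulus of an entry at \<open>l\<close>. Both sides are nonempty because both
  graphs are connected.\<close>

lemma has_abs_cut_delete:
  assumes sk: "skew s" "skew t" and pm: "minors_agree V s t"
    and con: "conn (dif s t) V" "conn (dif s (neg t)) V"
    and cut: "has_cut V s a" "a \<noteq> 0" and l: "l \<in> V" "V - {l} \<noteq> {}"
  shows "has_abs_cut (V - {l}) s \<bar>a\<bar>"
proof -
  obtain P where P: "P \<subseteq> V" "P \<noteq> {}" "P \<noteq> V" "\<forall>p\<in>P. \<forall>q\<in>V - P. s p q = a"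
    using cut(1) unfolding has_cut_def by blast
  show ?thesis
  proof (cases "P - {l} \<noteq> {} \<and> V - P - {l} \<noteq> {}")
    case True
    then have "P - {l} \<subseteq> V - {l} \<and> P - {l} \<noteq> {} \<and> P - {l} \<noteq> V - {l} \<and>
       (\<forall>p\<in>P - {l}. \<forall>q\<in>V - {l} - (P - {l}). \<bar>s p q\<bar> = \<bar>a\<bar>)" using P by auto
    then show ?thesis unfolding has_abs_cut_def by blast
  next
    case False
    then have "P = {l} \<or> V - P = {l}" using P by blast
    then obtain c where c: "\<And>x. x \<in> V - {l} \<Longrightarrow> s l x = c" "\<bar>c\<bar> = \<bar>a\<bar>"
    proof
      assume "P = {l}" then show ?thesis using P(4) that[of a] by blast
    next
      assume Q: "V - P = {l}"
      have "s l x = - a" if "x \<in> V - {l}" for x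
        using that Q P(4) skewD[OF sk(1), of l x] by auto
      then show ?thesis using that[of "- a"] by simp
    qed
    define M where "M = {x \<in> V - {l}. dif s t l x}"
    have "\<exists>q\<in>V - {l}. dif s t l q" using conn_neighbour[OF con(1) l] by blast
    then have "M \<noteq> {}" unfolding M_def by blast
    moreover have "\<exists>q\<in>V - {l}. dif s (neg t) l q" using conn_neighbour[OF con(2) l] by blast
    then have "M \<noteq> V - {l}" using dif_nonzero(3)[OF pm] l(1) unfolding M_def by blast
    moreover have "\<bar>s u w\<bar> = \<bar>a\<bar>" if "u \<in> M" "w \<in> V - {l} - M" for u w
    proof -
      have uw: "u \<in> V" "w \<in> V" "dif s t l u" "\<not> dif s t l w" "u \<noteq> l" "w \<noteq> l"
        using that unfolding M_def by auto
      have lw: "dif s (neg t) l w" using dif_cases[OF pm l(1) uw(2)] uw(4) c(1)[of w] uw c(2) cut(2) by auto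
      show ?thesis
      proof (cases "dif s t u w")
        case True
        have "\<not> dif s (neg t) w u" "\<not> dif s (neg t) l u"
          using dif_nonzero(3)[OF pm uw(2,1) dif_sym[OF sk True]] dif_nonzero(3)[OF pm l(1) uw(1,3)] by auto
        then have "s l u = s w u"
          using triangle[OF sk(1) skew_neg[OF sk(2)] minors_agree_neg[OF pm] l(1) uw(2) uw(1) lw] by blast
        then show ?thesis using c uw skewD[OF sk(1), of u w] by auto
      next
        case False
        then have "s l w = s u w" using triangle[OF sk pm l(1) uw(1,2,3,4)] by blast
        then show ?thesis using c uw by auto
      qed
    qed
    moreover have "M \<subseteq> V - {l}" unfolding M_def by blast
    ultimately show ?thesis unfolding has_abs_cut_def by blast
  qed
qed

text \<open>Let \<open>C\<close> be a component of the kept graph on \<open>V - {k}\<close> and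
  \<open>Z\<close> the rest. All entries from \<open>Z\<close> to \<open>C\<close> equal one
  constant \<open>c\<close>, and all kept pairs ending in \<open>k\<close> have entry
  \<open>b\<close>. A minor of order 4 yields \<open>b = c\<close> or \<open>b = - c\<close>, and
  the sign decides whether \<open>Z\<close> or \<open>V - C\<close> is a side of the cut.\<close>

lemma cut_if_disconnected_by_vertex:
  assumes fin: "finite V" and sk: "skew s" "skew t" and pm: "minors_agree V s t"
    and con: "conn (dif s t) V" "conn (dif s (neg t)) V"
    and k: "k \<in> V" "V - {k} \<noteq> {}" "\<not> conn (dif s (neg t)) (V - {k})"
  shows "\<exists>a. a \<noteq> 0 \<and> has_cut V s a"
proof -
  let ?D = "dif s t" and ?E = "dif s (neg t)"
  note skn = sk(1) skew_neg[OF sk(2)] and pmn = minors_agree_neg[OF pm]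
  have Dsym: "?D i j \<Longrightarrow> ?D j i" for i j using dif_sym[OF sk] .
  have Esym: "?E i j \<Longrightarrow> ?E j i" for i j using dif_sym[OF skn] .
  have triD: "s i m = s j m" if "i \<in> V" "j \<in> V" "m \<in> V" "?D i j" "\<not> ?D i m" "\<not> ?D j m" for i j m
    using triangle[OF sk pm] that by blast
  have triE: "s i m = s j m" if "i \<in> V" "j \<in> V" "m \<in> V" "?E i j" "\<not> ?E i m" "\<not> ?E j m" for i j m
    using triangle[OF skn pmn] that by blast
  have DE: "\<not> ?E i j" if "i \<in> V" "j \<in> V" "?D i j" for i j using dif_nonzero(3)[OF pm] that by blast
  have Dnz: "s i j \<noteq> 0" if "i \<in> V" "j \<in> V" "?D i j" for i j using dif_nonzero(1)[OF pm] that by blast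
  have col: "?D i j" if "i \<in> V" "j \<in> V" "\<not> ?E i j" "s i j \<noteq> 0" for i j
    using dif_cases[OF pm] that by blast
  \<comment> \<open>Choosing the component of a vertex reversed towards \<open>k\<close> makes
    \<open>C\<close> contain both kinds of neighbours of \<open>k\<close>: \<open>y0\<close>
    reversed and, by connectivity of the kept graph on \<open>V\<close>, \<open>x0\<close>
    kept.\<close>
  obtain y0 where y0: "y0 \<in> V - {k}" "?D k y0"
    using conn_neighbour[OF con(1) k(1,2)] .
  obtain C where C: "y0 \<in> C" "C \<subseteq> V - {k}" "conn ?E C" "\<forall>c\<in>C. \<forall>z\<in>V - {k} - C. \<not> ?E c z"
    using component_exists[where G = ?E, OF finite_Diff[OF fin] y0(1) Esym] by blast
  define Z where "Z = V - {k} - C"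
  have Z0: "Z \<noteq> {}"
  proof
    assume "Z = {}"
    then have "V - {k} = C" using C(2) unfolding Z_def by blast
    then show False using C(3) k(3) by simp
  qed
  have ZV: "z \<in> V" "z \<noteq> k" "z \<notin> C" if "z \<in> Z" for z using that unfolding Z_def by auto
  have CV: "c \<in> V" "c \<noteq> k" if "c \<in> C" for c using that C(2) by auto
  have ZC: "\<not> ?E z c" "\<not> ?E c z" if "z \<in> Z" "c \<in> C" for z c
    using C(4) that Esym unfolding Z_def by blast+
  obtain x0 where x0: "x0 \<in> C" "?E k x0"
  proof -
    have "C \<subseteq> V" "C \<noteq> {}" "C \<noteq> V" using C(1,2) k(1) by auto
    then obtain p q where pq: "p \<in> C" "q \<in> V - C" "?E p q" by (rule connD[OF con(2)])
    then have "q = k" using C(4) pq by blast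
    then show ?thesis using that[of p] pq Esym by blast
  qed
  \<comment> \<open>A part of \<open>Z\<close> that no kept pair joins to the rest of
    \<open>Z\<close> can be left only through \<open>k\<close>.\<close>
  have Zout: "\<exists>r\<in>R. ?E k r" if R: "R \<subseteq> Z" "R \<noteq> {}" "\<And>r z. r \<in> R \<Longrightarrow> z \<in> Z - R \<Longrightarrow> \<not> ?E r z" for R
  proof -
    have "R \<subseteq> V" "R \<noteq> V" using R(1) ZV k(1) by auto
    then obtain p q where pq: "p \<in> R" "q \<in> V - R" "?E p q" using connD[OF con(2) _ R(2)] by metis
    then have "q = k" using R(1,3) ZC unfolding Z_def by blast
    then show ?thesis using pq Esym by blast
  qed
  obtain z0 where z0: "z0 \<in> Z" "?E k z0" using Zout[of Z] Z0 by blast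
  have constC: "s z c = s z c'" if "z \<in> Z" "c \<in> C" "c' \<in> C" for z c c'
  proof -
    have "s c z = s c' z"
      by (rule component_const[OF skn pmn _ C(3) _ _ that(2,3)]) (use that CV ZV ZC in auto)
    then show ?thesis using skewD[OF sk(1), of z c] skewD[OF sk(1), of z c'] by linarith
  qed
  define c where "c = s k y0"
  have c0: "c \<noteq> 0" using Dnz[of k y0] y0 k(1) unfolding c_def by blast
  have cE: "s z y = s k y" if "z \<in> Z" "?E k z" "y \<in> C" "?D k y" for z y
  proof -
    have "\<not> ?E k y" "\<not> ?E z y" using DE that CV k(1) ZC by blast+
    then show ?thesis using triE[of k z y] that ZV(1)[of z] CV(1)[of y] k(1) by simp
  qed
  have zc: "s z x = c" if "z \<in> Z" "x \<in> C" for z x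
  proof (rule ccontr)
    assume n: "s z x \<noteq> c"
    let ?R = "{r \<in> Z. s r y0 \<noteq> c}"
    have "z \<in> ?R" using n that constC[OF that C(1)] by auto
    moreover have "\<not> ?E r z'" if "r \<in> ?R" "z' \<in> Z - ?R" for r z'
    proof
      assume "?E r z'"
      then have "s r y0 = s z' y0" using triE[of r z' y0] that ZV C(1) CV ZC by blast
      then show False using that by auto
    qed
    ultimately obtain r where "r \<in> ?R" "?E k r" using Zout[of ?R] by blast
    then show False using cE[of r y0] C(1) y0(2) unfolding c_def by auto
  qed
  have zxD: "?D z x" if "z \<in> Z" "x \<in> C" for z x
    using col[of z x] zc[OF that] c0 ZV(1)[of z] CV(1)[of x] ZC(1)[OF that] that by metis
  have ky: "s k y = c" if "y \<in> C" "?D k y" for y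
    using cE[OF z0 that] zc[OF z0(1) that(1)] by simp
  define b where "b = s z0 k"
  have xz: "s x k = s z k" if "z \<in> Z" "?E k z" "x \<in> C" "?E k x" for x z
  proof -
    have "\<not> ?D k x" "\<not> ?D k z" using DE that CV ZV k(1) by blast+
    then show ?thesis using triD[of z x k] zxD[OF that(1,3)] that ZV(1)[of z] CV(1)[of x] k(1) Dsym by metis
  qed
  have xb: "s x k = b" if "x \<in> C" "?E k x" for x using xz[OF z0 that] unfolding b_def .
  have zb: "s z k = b" if "z \<in> Z" "?E k z" for z using xz[OF that x0] xb[OF x0] by simp
  have Ccol: "?D k x \<or> ?E k x" if "x \<in> C" for x
  proof -
    have "s k x \<noteq> 0"
      using no_rainbow[OF sk pm ZV(1)[OF z0(1)] CV(1)[OF that] k(1) zxD[OF z0(1) that] Esym[OF z0(2)]]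
        skewD[OF sk(1), of k x] by linarith
    then show ?thesis using dif_cases[OF pm] k(1) CV that by blast
  qed
  have Zcol: "?D k z \<or> ?E k z" if "z \<in> Z" for z
  proof -
    have "s z k \<noteq> 0"
      using no_rainbow[OF sk pm CV(1)[OF x0(1)] ZV(1)[OF that] k(1) Dsym[OF zxD[OF that x0(1)]] Esym[OF x0(2)]] .
    then show ?thesis using dif_cases[OF pm, of z k] k(1) ZV(1)[OF that] Dsym[of z k] Esym[of z k] by blast
  qed
  have zD: "s z k = c" if "z \<in> Z" "?D k z" for z
  proof -
    have "\<not> ?E k z" "\<not> ?E x0 z" using DE that ZV k(1) ZC x0(1) by blast+
    then have "s k z = s x0 z" using triE[of k x0 z] x0 that ZV(1)[of z] CV(1)[of x0] k(1) by blast
    then show ?thesis using zc[OF that(1) x0(1)] skewD[OF sk(1), of k z] skewD[OF sk(1), of x0 z] by linarith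
  qed
  \<comment> \<open>Connectivity of \<open>C\<close> provides a kept pair \<open>y\<close>,
    \<open>x\<close> in \<open>C\<close> with \<open>y\<close> reversed and \<open>x\<close> kept
    towards \<open>k\<close>. All entries on \<open>x\<close>, \<open>y\<close>, \<open>k\<close>,
    \<open>z0\<close> are then \<open>b\<close> or \<open>c\<close> up to sign, and the two squared
    Pfaffians differ by \<open>4 * b * c * (c * c - b * b)\<close>.\<close>
  have bc: "b = c \<or> b = - c"
  proof -
    let ?Y = "{y \<in> C. ?D k y}"
    have "x0 \<notin> ?Y" using DE[OF k(1)] x0 CV by blast
    then have "?Y \<subseteq> C" "?Y \<noteq> {}" "?Y \<noteq> C" using C(1) y0(2) x0(1) by blast+
    then obtain y x where "y \<in> ?Y" "x \<in> C - ?Y" "?E y x" by (rule connD[OF C(3)])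
    then have yx: "y \<in> C" "?D k y" "x \<in> C" "?E y x" "?E k x" using Ccol[of x] by auto
    have v: "x \<in> V" "y \<in> V" "z0 \<in> V" using yx CV ZV z0 by auto
    have "\<not> ?D x k" "\<not> ?D x y" using DE yx v k(1) Dsym by blast+
    then have "s k x = s y x" using triD[of k y x] yx v k(1) Dsym by blast
    then have xy: "s x y = b" using xb[OF yx(3,5)] skewD[OF sk(1), of x y] skewD[OF sk(1), of x k] by linarith
    have val: "s x k = b" "s y k = - c" "s x z0 = - c" "s y z0 = - c" "s k z0 = - b"
      using xb[OF yx(3,5)] zc[OF z0(1) yx(1)] zc[OF z0(1) yx(3)] ky[OF yx(1,2)] b_def
        skewD[OF sk(1), of y k] skewD[OF sk(1), of x z0] skewD[OF sk(1), of y z0] skewD[OF sk(1), of k z0]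
      by linarith+
    have neg: "t i j = - s i j" if "?D i j" "i \<in> V" "j \<in> V" for i j using dif_nonzero(2)[OF pm] that by blast
    have pos: "t i j = s i j" if "?E i j" "i \<in> V" "j \<in> V" for i j using DE that unfolding dif_def by blast
    have tval: "t x y = b" "t x k = b" "t y k = c" "t x z0 = c" "t y z0 = c" "t k z0 = - b"
      using pos[OF Esym[OF yx(4)]] pos[OF Esym[OF yx(5)]] neg[OF Dsym[OF yx(2)]]
        neg[OF Dsym[OF zxD[OF z0(1) yx(3)]]] neg[OF Dsym[OF zxD[OF z0(1) yx(1)]]] pos[OF z0(2)]
        v k(1) xy val by auto
    have "(pfaff s x y k z0)\<^sup>2 = (pfaff t x y k z0)\<^sup>2"
      using pm v k(1) unfolding minors_agree_def by blast
    then have "(- (b * b) + b * c + c * c)\<^sup>2 = (- (b * b) - b * c + c * c)\<^sup>2"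
      unfolding pfaff_def xy val tval by simp
    then have "b * c * (c * c - b * b) = 0" by (simp add: power2_eq_square algebra_simps)
    moreover have "b \<noteq> 0" using Dnz dif_nonzero(1)[OF pmn k(1) _ z0(2)] v \<open>s k z0 = - b\<close> by force
    ultimately have "c * c = b * b" using c0 by simp
    then show ?thesis using square_eq_iff by metis
  qed
  show ?thesis
  proof (cases "b = c")
    case True
    have "has_cut V s c"
    proof (rule has_cutI[of Z])
      fix p q assume p: "p \<in> Z" and "q \<in> V - Z"
      then have "q = k \<or> q \<in> C" unfolding Z_def by blast
      then show "s p q = c" using zc[OF p] zb[OF p] zD[OF p] Zcol[OF p] True by blast
    qed (use Z0 ZV k in blast)+
    then show ?thesis using c0 by blast
  next
    case False
    then have b: "b = - c" using bc by blast
    have "has_cut V s c"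
    proof (rule has_cutI[of "V - C"])
      fix p q assume p: "p \<in> V - C" and "q \<in> V - (V - C)"
      then have q: "q \<in> C" by blast
      have "s k q = c" using ky[OF q] xb[OF q] Ccol[OF q] b skewD[OF sk(1), of k q] by auto
      then show "s p q = c" using zc[OF _ q] p unfolding Z_def by blast
    qed (use C(1,2) k(1) in blast)+
    then show ?thesis using c0 by blast
  qed
qed

text \<open>The induction passes to \<open>V - {k}\<close>, which requires both graphs to stay
  connected there; if they do not, a cut of \<open>V\<close> comes directly from the previous lemma,
  applied to \<open>t\<close> or to \<open>neg t\<close>.\<close>

theorem cut_if_both_connected:
  assumes "finite V" "card V \<ge> 2" "skew s" "skew t" "minors_agree V s t"
    and "conn (dif s t) V" "conn (dif s (neg t)) V"
  shows "\<exists>a. a \<noteq> 0 \<and> has_cut V s a"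
  using assms
proof (induction "card V" arbitrary: V rule: less_induct)
  case less
  note fin = less.prems(1) and sk = less.prems(3,4) and pm = less.prems(5) and con = less.prems(6,7)
  have big: "V - {k} \<noteq> {}" for k
  proof
    assume "V - {k} = {}"
    then have "card V \<le> card {k}" by (intro card_mono) auto
    then show False using less.prems(2) by simp
  qed
  show ?case
  proof (cases "\<forall>k\<in>V. conn (dif s t) (V - {k}) \<and> conn (dif s (neg t)) (V - {k})")
    case False
    then obtain k where k: "k \<in> V" "\<not> conn (dif s t) (V - {k}) \<or> \<not> conn (dif s (neg t)) (V - {k})" by blast
    from k(2) show ?thesis
    proof
      assume "\<not> conn (dif s t) (V - {k})"
      then show ?thesis
        using cut_if_disconnected_by_vertex[OF fin sk(1) skew_neg[OF sk(2)] minors_agree_neg[OF pm] con(2) _ k(1) big] con(1)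
        by simp
    next
      assume "\<not> conn (dif s (neg t)) (V - {k})"
      then show ?thesis using cut_if_disconnected_by_vertex[OF fin sk pm con k(1) big] by simp
    qed
  next
    case True
    \<comment> \<open>Two vertices carry a single pair, which cannot be both reversed and kept. This
      excludes two vertices, and three after a deletion, so that Moon's theorem applies.\<close>
    have two: False if W2: "W \<subseteq> V" "card W = 2" "conn (dif s t) W" "conn (dif s (neg t)) W" for W
    proof -
      obtain x y where W: "W = {x, y}" "x \<noteq> y" using W2(2) by (meson card_2_iff)
      have "dif s t x y" "dif s (neg t) x y"
        using W2(3,4)[unfolded conn_def, rule_format, of "{x}"] W by auto
      then show False using dif_nonzero(3)[OF pm] W W2(1) by blast
    qed
    have card4: "card V \<ge> 4"
    proof (rule ccontr)
      assume "\<not> ?thesis"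
      then consider "card V = 2" | "card V = 3" using less.prems(2) by linarith
      then show False
      proof cases
        case 1 then show False using two[of V] con by blast
      next
        case 2
        then obtain k where k: "k \<in> V" by fastforce
        then have "card (V - {k}) = 2" using 2 fin by simp
        then show False using two[of "V - {k}"] True k by blast
      qed
    qed
    have IH: "\<exists>a. a \<noteq> 0 \<and> has_cut (V - {k}) s a" if "k \<in> V" for k
      using less.hyps[of "V - {k}"] that fin card4 sk minors_agree_subset[OF pm, of "V - {k}"] True
      by (auto simp: card_Diff_singleton)
    show ?thesis
    proof (rule ccontr)
      assume no: "\<not> ?thesis"
      obtain k where k: "k \<in> V" using card4 by fastforce
      obtain a where a: "a \<noteq> 0" "has_cut (V - {k}) s a" using IH[OF k] by blast
      \<comment> \<open>Without a cut of \<open>V\<close>, Moon's theorem for the constant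
        \<open>a\<close> provides \<open>l\<close>. The cut of \<open>V - {l}\<close> has some
        constant \<open>b\<close>, and on the common subset without \<open>k\<close> and
        \<open>l\<close> both moduli survive, so \<open>b\<close> is \<open>a\<close> or
        \<open>- a\<close>: a contradiction.\<close>
      obtain l where l: "l \<in> V" "\<not> has_cut (V - {l}) s a"
        using cutless_delete_vertex[OF fin card4 sk(1) a(1)] no a(1) by blast
      obtain b where b: "b \<noteq> 0" "has_cut (V - {l}) s b" using IH[OF l(1)] by blast
      have kl: "k \<noteq> l" using a l by blast
      have "card (V - {k} - {l}) \<ge> 2" using card4 k l kl fin by (simp add: card_Diff_singleton)
      then have ne: "V - {k} - {l} \<noteq> {}" by (metis card.empty not_numeral_le_zero)
      then have ne': "V - {l} - {k} \<noteq> {}" by blast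
      have "has_abs_cut (V - {k} - {l}) s \<bar>a\<bar>"
        using has_abs_cut_delete[OF sk minors_agree_subset[OF pm] _ _ a(2,1) _ ne] True k l kl by blast
      moreover have "has_abs_cut (V - {l} - {k}) s \<bar>b\<bar>"
        using has_abs_cut_delete[OF sk minors_agree_subset[OF pm] _ _ b(2,1) _ ne'] True k l kl by blast
      moreover have "V - {l} - {k} = V - {k} - {l}" by blast
      ultimately have "\<bar>a\<bar> = \<bar>b\<bar>" using has_abs_cut_unique[OF sk(1)] by metis
      then have "has_cut (V - {l}) s a" using b(2) has_cut_uminus[OF sk(1) b(2)] by (auto simp: abs_eq_iff)
      then show False using l(2) by simp
    qed
  qed
qed

section \<open>Clan inversions\<close>

definition agree :: "'a set \<Rightarrow> ('a \<Rightarrow> 'a \<Rightarrow> real) \<Rightarrow> ('a \<Rightarrow> 'a \<Rightarrow> real) \<Rightarrow> bool" where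
  "agree V s t \<longleftrightarrow> (\<forall>i\<in>V. \<forall>j\<in>V. s i j = t i j)"

text \<open>The base case is agreement on \<open>V\<close> instead of equality, since values outside
  \<open>V\<close> carry no information.\<close>

inductive reach :: "'a set \<Rightarrow> ('a \<Rightarrow> 'a \<Rightarrow> real) \<Rightarrow> ('a \<Rightarrow> 'a \<Rightarrow> real) \<Rightarrow> bool" for V where
  agree: "agree V s t \<Longrightarrow> reach V s t"
| step: "sclan V s X \<Longrightarrow> reach V (flip X s) t \<Longrightarrow> reach V s t"

lemma agree_sclan: "agree V s' s \<Longrightarrow> sclan V s X \<Longrightarrow> sclan V s' X"
  unfolding agree_def sclan_def by (metis DiffD1 in_mono)

lemma agree_flip: "agree V s' s \<Longrightarrow> agree V (flip X s') (flip X s)"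
  unfolding agree_def flip_def by simp

lemma reach_cong: "reach V s t \<Longrightarrow> agree V s' s \<Longrightarrow> reach V s' t"
proof (induction arbitrary: s' rule: reach.induct)
  case (agree s t)
  then show ?case by (intro reach.agree) (simp add: agree_def)
next
  case (step s X t)
  then show ?case using agree_sclan agree_flip reach.step by metis
qed

lemma reach_trans: "reach V s t \<Longrightarrow> reach V t u \<Longrightarrow> reach V s u"
proof (induction rule: reach.induct)
  case (agree s t)
  then show ?case using reach_cong by blast
next
  case (step s X t)
  then show ?case using reach.step by blast
qed

lemma reach_flip: "sclan V s X \<Longrightarrow> reach V s (flip X s)"
  by (rule reach.step, assumption, rule reach.agree) (simp add: agree_def)

lemma minors_agree_if_reach: "reach V s t \<Longrightarrow> skew s \<Longrightarrow> minors_agree V s t"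
proof (induction rule: reach.induct)
  case (agree s t)
  then show ?case by (intro minors_agree_cong) (simp add: agree_def)
next
  case (step s X t)
  then show ?case using minors_agree_flip skew_flip minors_agree_trans by metis
qed

lemma sclan_flip:
  assumes "skew s" "sclan V s A" "sclan V s B" "A \<subseteq> B \<or> A \<inter> B = {}"
  shows "sclan V (flip B s) A"
  unfolding sclan_def
proof (intro conjI ballI)
  show "A \<subseteq> V" using assms(2) unfolding sclan_def by blast
  fix i j k assume ij: "i \<in> A" "j \<in> A" and k: "k \<in> V - A"
  then have "s i k = s j k" using assms(2) unfolding sclan_def by blast
  moreover have "s k i = s k j"
    using calculation skewD[OF assms(1), of k i] skewD[OF assms(1), of k j] by linarith
  moreover have "i \<in> B \<longleftrightarrow> j \<in> B" using assms(4) ij by blast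
  ultimately show "flip B s i k = flip B s j k" unfolding flip_def by simp
qed

text \<open>Inverting \<open>Y \<union> Z\<close> and then \<open>Y\<close> and \<open>Z\<close>
  restores the entries inside \<open>Y\<close> and inside \<open>Z\<close>, so only the pairs
  between them end up reversed.\<close>

lemma reach_swap:
  assumes sk: "skew s" and cl: "sclan V s Y" "sclan V s Z" "sclan V s (Y \<union> Z)" and dis: "Y \<inter> Z = {}"
  shows "reach V s (\<lambda>i j. if i \<in> Y \<and> j \<in> Z \<or> i \<in> Z \<and> j \<in> Y then s j i else s i j)"
proof -
  let ?s1 = "flip (Y \<union> Z) s"
  let ?s2 = "flip Y ?s1"
  have sk1: "skew ?s1" using skew_flip[OF sk] .
  have c1: "sclan V ?s1 Y" "sclan V ?s1 Z" using sclan_flip[OF sk _ cl(3)] cl by blast+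
  have c2: "sclan V ?s2 Z" using sclan_flip[OF sk1 c1(2,1)] dis by blast
  have "reach V s (flip Z ?s2)"
    using reach_flip[OF cl(3)] reach_flip[OF c1(1)] reach_flip[OF c2] reach_trans by metis
  moreover have "flip Z ?s2 = (\<lambda>i j. if i \<in> Y \<and> j \<in> Z \<or> i \<in> Z \<and> j \<in> Y then s j i else s i j)"
    using dis unfolding flip_def by (intro ext) auto
  ultimately show ?thesis by simp
qed

text \<open>A clan of a clan is a clan of the whole set, and inverting it leaves the entries between
  \<open>X\<close> and its complement untouched, so \<open>X\<close> remains a clan.\<close>

lemma reach_within_clan:
  "reach X s t \<Longrightarrow> sclan V s X \<Longrightarrow>
    reach V s (\<lambda>i j. if i \<in> X \<and> j \<in> X then t i j else s i j)"
proof (induction rule: reach.induct)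
  case (agree s t)
  then show ?case by (intro reach.agree) (auto simp: agree_def)
next
  case (step s Y t)
  have Y: "Y \<subseteq> X" using step.hyps(1) unfolding sclan_def by blast
  have X: "X \<subseteq> V" using step.prems unfolding sclan_def by blast
  have cY: "sclan V s Y"
    unfolding sclan_def
  proof (intro conjI ballI)
    show "Y \<subseteq> V" using X Y by blast
    fix i j k assume "i \<in> Y" "j \<in> Y" "k \<in> V - Y"
    then show "s i k = s j k"
      using step.hyps(1) step.prems Y unfolding sclan_def by (cases "k \<in> X") blast+
  qed
  have same: "flip Y s i j = s i j" if "\<not> (i \<in> X \<and> j \<in> X)" for i j
    using that Y unfolding flip_def by auto
  have "sclan V (flip Y s) X"
    unfolding sclan_def
  proof (intro conjI ballI)
    fix i j k assume ij: "i \<in> X" "j \<in> X" and k: "k \<in> V - X"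
    then have "s i k = s j k" using step.prems unfolding sclan_def by blast
    then show "flip Y s i k = flip Y s j k" using same[of i k] same[of j k] k by simp
  qed (rule X)
  then have "reach V (flip Y s) (\<lambda>i j. if i \<in> X \<and> j \<in> X then t i j else flip Y s i j)"
    by (rule step.IH)
  moreover have "(\<lambda>i j. if i \<in> X \<and> j \<in> X then t i j else flip Y s i j)
      = (\<lambda>i j. if i \<in> X \<and> j \<in> X then t i j else s i j)"
    using same by (intro ext) auto
  ultimately show ?case using reach.step[OF cY] by simp
qed

text \<open>Moves on the quotient by a clan \<open>X\<close>, represented by one element \<open>x\<close> of \<open>X\<close>, lift to moves that
  keep \<open>X\<close> a clan: a clan of the quotient containing \<open>x\<close> is enlarged by all of \<open>X\<close>.\<close>

lemma reach_quotient:
  assumes "reach W s t" "W = insert x (V - X)" "x \<in> X" "agree W s' s" "sclan V s' X" "skew s'"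
  shows "\<exists>u. reach V s' u \<and> sclan V u X \<and> agree W u t \<and> skew u"
  using assms
proof (induction arbitrary: s' rule: reach.induct)
  case (agree s t)
  then have "agree W s' t" unfolding agree_def by simp
  moreover have "reach V s' s'" by (rule reach.agree) (simp add: agree_def)
  ultimately show ?case using agree.prems by blast
next
  case (step s Y t)
  note W = step.prems(1) and x = step.prems(2) and ag = step.prems(3) and cX = step.prems(4)
    and sk = step.prems(5)
  have XV: "X \<subseteq> V" using cX unfolding sclan_def by blast
  have cY: "sclan W s' Y" using agree_sclan[OF ag step.hyps(1)] .
  have YW: "Y \<subseteq> W" using cY unfolding sclan_def by blast
  define Y' where "Y' = (if x \<in> Y then Y \<union> X else Y)"
  \<comment> \<open>\<open>r\<close> collapses \<open>X\<close> to \<open>x\<close>. On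
    \<open>V\<close> the set \<open>Y'\<close> is the preimage of \<open>Y\<close>, and outside
    \<open>X\<close> times \<open>X\<close> the function \<open>s'\<close> factors through
    \<open>r\<close>.\<close>
  define r where "r = (\<lambda>i. if i \<in> X then x else i)"
  have rY: "i \<in> Y' \<longleftrightarrow> r i \<in> Y" if "i \<in> V" for i
    using that YW W x unfolding Y'_def r_def by auto
  have rW: "r i \<in> W" if "i \<in> V" for i using that W unfolding r_def by auto
  have Y'V: "Y' \<subseteq> V" using YW W x XV unfolding Y'_def by auto
  have rs: "s' i k = s' (r i) (r k)" if "i \<in> V" "k \<in> V" "\<not> (i \<in> X \<and> k \<in> X)" for i k
  proof -
    have c: "s' i k = s' x k" if "i \<in> X" "k \<in> V - X" for i k
      using cX x that unfolding sclan_def by blast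
    have "s' i k = s' i x" if "k \<in> X" "i \<in> V - X"
      using c[OF that] skewD[OF sk, of i k] skewD[OF sk, of i x] by linarith
    then show ?thesis using c[of i k] that unfolding r_def by auto
  qed
  have cY': "sclan V s' Y'"
    unfolding sclan_def
  proof (intro conjI ballI)
    show "Y' \<subseteq> V" by (rule Y'V)
    fix i j k assume ij: "i \<in> Y'" "j \<in> Y'" and k: "k \<in> V - Y'"
    have nX: "\<not> (p \<in> X \<and> k \<in> X)" if "p \<in> Y'" for p
      using that k rY[of p] rY[of k] Y'V unfolding r_def by auto
    have "s' i k = s' (r i) (r k)" "s' j k = s' (r j) (r k)"
      using rs nX ij k Y'V by blast+
    moreover have "s' (r i) (r k) = s' (r j) (r k)"
      using cY rY[of i] rY[of j] rY[of k] ij k Y'V rW[of k] unfolding sclan_def by blast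
    ultimately show "s' i k = s' j k" by simp
  qed
  have Y'W: "i \<in> Y' \<longleftrightarrow> i \<in> Y" if "i \<in> W" for i
    using that W x YW unfolding Y'_def by auto
  have "agree W (flip Y' s') (flip Y s)"
    using ag Y'W unfolding agree_def flip_def by auto
  moreover have "X \<subseteq> Y' \<or> X \<inter> Y' = {}"
    using YW W x unfolding Y'_def by auto
  then have "sclan V (flip Y' s') X" using sclan_flip[OF sk cX cY'] by blast
  ultimately obtain u where "reach V (flip Y' s') u" "sclan V u X" "agree W u t" "skew u"
    using step.IH[OF W x _ _ skew_flip[OF sk]] by blast
  then show ?case using reach.step[OF cY'] by blast
qed

section \<open>Skew functions without nontrivial clans\<close>

lemma conn_if_no_clan:
  assumes fin: "finite V" and sk: "skew s" "skew t" and pm: "minors_agree V s t"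
    and prim: "\<And>X. sclan V s X \<Longrightarrow> card X \<ge> 2 \<Longrightarrow> X = V"
    and ij: "i \<in> V" "j \<in> V" "dif s t i j"
  shows "conn (dif s t) V"
proof -
  obtain C where C: "i \<in> C" "C \<subseteq> V" "conn (dif s t) C" "\<forall>c\<in>C. \<forall>y\<in>V - C. \<not> dif s t c y"
    using component_exists[where G = "dif s t", OF fin ij(1) dif_sym[OF sk]] by blast
  have "j \<in> C" using C ij by blast
  moreover have "i \<noteq> j" using dif_nonzero(1)[OF pm ij] skew_self[OF sk(1)] by auto
  ultimately have "card {i, j} \<le> card C" using C(1,2) fin by (intro card_mono) (auto intro: finite_subset)
  then have "card C \<ge> 2" using \<open>i \<noteq> j\<close> by simp
  moreover have "sclan V s C"
    unfolding sclan_def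
  proof (intro conjI ballI)
    fix x y k assume "x \<in> C" "y \<in> C" "k \<in> V - C"
    then show "s x k = s y k" using component_const[OF sk pm C(2,3)] C(4) by blast
  qed (use C in blast)
  ultimately show ?thesis using prim C(3) by blast
qed

text \<open>If \<open>t\<close> is neither \<open>s\<close> nor its negative on \<open>V\<close>,
  each of the two graphs has an edge. The component of an edge is a clan with at least two elements,
  hence all of \<open>V\<close>, so both graphs are connected and a cut exists.\<close>

lemma reach_if_no_clan:
  assumes fin: "finite V" and sk: "skew s" "skew t" and pm: "minors_agree V s t"
    and prim: "\<And>X. sclan V s X \<Longrightarrow> card X \<ge> 2 \<Longrightarrow> X = V"
  shows "reach V s t"
proof (cases "agree V s t \<or> agree V s (neg t)")
  case True
  then show ?thesis
  proof
    assume "agree V s t" then show ?thesis by (rule reach.agree)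
  next
    assume a: "agree V s (neg t)"
    have "flip V s i j = t i j" if "i \<in> V" "j \<in> V" for i j
      using that a skewD[OF sk(1), of j i] unfolding flip_def agree_def by auto
    then have "agree V (flip V s) t" unfolding agree_def by blast
    moreover have "sclan V s V" unfolding sclan_def by blast
    ultimately show ?thesis using reach.step reach.agree by blast
  qed
next
  case False
  then obtain i j where ij: "i \<in> V" "j \<in> V" "dif s t i j" unfolding agree_def dif_def by metis
  obtain k l where kl: "k \<in> V" "l \<in> V" "dif s (neg t) k l"
    using False unfolding agree_def dif_def by metis
  have con: "conn (dif s t) V" "conn (dif s (neg t)) V"
    using conn_if_no_clan[OF fin sk pm prim ij]
      conn_if_no_clan[OF fin sk(1) skew_neg[OF sk(2)] minors_agree_neg[OF pm] prim kl] by blast+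
  have ne: "i \<noteq> j" "k \<noteq> l"
    using dif_nonzero(1)[OF pm ij] dif_nonzero(1)[OF minors_agree_neg[OF pm] kl] skew_self[OF sk(1)] by auto
  \<comment> \<open>A kept pair and a reversed pair together involve at least three vertices, so one
    side of the cut has two elements and is a forbidden clan.\<close>
  have "\<not> {k, l} \<subseteq> {i, j}"
  proof
    assume "{k, l} \<subseteq> {i, j}"
    then have "k = i \<and> l = j \<or> k = j \<and> l = i" using ne by blast
    then show False
      using dif_nonzero(3)[OF pm ij] dif_nonzero(3)[OF pm ij(2,1) dif_sym[OF sk ij(3)]] kl(3) by auto
  qed
  then obtain m where m: "m \<in> V" "m \<notin> {i, j}" using kl by blast
  have "card {i, j, m} \<le> card V" using ij m fin by (intro card_mono) auto
  then have card3: "card V \<ge> 3" using ne m by (auto simp: card_insert_if)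
  then obtain a where "has_cut V s a" using cut_if_both_connected[OF fin _ sk pm con] by auto
  then obtain P where P: "P \<subseteq> V" "P \<noteq> {}" "P \<noteq> V" "\<forall>p\<in>P. \<forall>q\<in>V - P. s p q = a"
    unfolding has_cut_def by blast
  have "sclan V s P" using P unfolding sclan_def by simp
  moreover have "sclan V s (V - P)"
    unfolding sclan_def
  proof (intro conjI ballI)
    fix x y k assume "x \<in> V - P" "y \<in> V - P" "k \<in> V - (V - P)"
    then have "s k x = a" "s k y = a" using P by auto
    then show "s x k = s y k" using skewD[OF sk(1), of x k] skewD[OF sk(1), of y k] by simp
  qed blast
  moreover have "card P + card (V - P) = card V"
    using card_Diff_subset[of P V] P(1) fin card_mono[of V P] by (simp add: finite_subset)
  then have "card P \<ge> 2 \<or> card (V - P) \<ge> 2" using card3 by linarith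
  ultimately show ?thesis using prim P(1-3) by blast
qed

theorem reach_if_minors_agree:
  assumes "finite V" "skew s" "skew t" "minors_agree V s t"
  shows "reach V s t"
  using assms
proof (induction "card V" arbitrary: V s t rule: less_induct)
  case less
  note fin = less.prems(1) and sk = less.prems(2,3) and pm = less.prems(4)
  \<comment> \<open>Collecting the clans of all functions reachable from \<open>s\<close> keeps
    maximality usable after further inversions.\<close>
  define Cl where "Cl = {X. X \<noteq> V \<and> 2 \<le> card X \<and> (\<exists>u. skew u \<and> reach V s u \<and> sclan V u X)}"
  have Cl: "Cl \<subseteq> Pow V" unfolding Cl_def sclan_def by auto
  show ?case
  proof (cases "Cl = {}")
    case True
    have "reach V s s" by (rule reach.agree) (simp add: agree_def)
    then have "X = V" if "sclan V s X" "2 \<le> card X" for X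
      using True that sk(1) unfolding Cl_def by blast
    then show ?thesis by (rule reach_if_no_clan[OF fin sk pm])
  next
    case False
    moreover have "finite Cl" using Cl fin finite_subset by auto
    ultimately obtain X where X: "X \<in> Cl" "\<And>X'. X' \<in> Cl \<Longrightarrow> X \<subseteq> X' \<Longrightarrow> X' = X"
      using finite_has_maximal[of Cl] by (metis (no_types, lifting))
    then obtain s1 where s1: "skew s1" "reach V s s1" "sclan V s1 X" and X2: "X \<noteq> V" "2 \<le> card X"
      unfolding Cl_def by blast
    have XV: "X \<subseteq> V" using s1(3) unfolding sclan_def by blast
    have pm1: "minors_agree V s1 t" using minors_agree_if_reach[OF s1(2) sk(1)] pm minors_agree_sym minors_agree_trans by blast
    obtain x where x: "x \<in> X" using X2(2) by fastforce
    define W where "W = insert x (V - X)"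
    have WV: "W \<subseteq> V" unfolding W_def using x XV by blast
    have "card X < card V" using XV X2(1) fin by (simp add: psubset_card_mono)
    have "card W = Suc (card (V - X))" unfolding W_def using fin x by simp
    moreover have "card (V - X) = card V - card X" using XV fin by (simp add: card_Diff_subset finite_subset)
    ultimately have "card W < card V" using X2(2) \<open>card X < card V\<close> by linarith
    then have "reach W s1 t"
      using less.hyps[of W s1 t] fin WV s1(1) sk(2) minors_agree_subset[OF pm1 WV] finite_subset by blast
    moreover have "agree W s1 s1" by (simp add: agree_def)
    ultimately obtain s2 where s2: "reach V s1 s2" "sclan V s2 X" "agree W s2 t" "skew s2"
      using reach_quotient[OF _ W_def x _ s1(3,1)] by blast
    have pm2: "minors_agree V s2 t" using minors_agree_if_reach[OF s2(1) s1(1)] pm1 minors_agree_sym minors_agree_trans by blast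
    have "reach X s2 t"
      using less.hyps[OF \<open>card X < card V\<close> _ s2(4) sk(2) minors_agree_subset[OF pm2 XV]] fin XV finite_subset by blast
    \<comment> \<open>\<open>u\<close> agrees with \<open>t\<close> inside \<open>X\<close> and on
      the quotient \<open>W\<close>, so only pairs between \<open>X\<close> and its complement can
      still be reversed.\<close>
    define u where "u = (\<lambda>i j. if i \<in> X \<and> j \<in> X then t i j else s2 i j)"
    have ru: "reach V s2 u" unfolding u_def by (rule reach_within_clan[OF \<open>reach X s2 t\<close> s2(2)])
    have "u j i = - u i j" for i j
      unfolding u_def using skewD[OF s2(4), of j i] skewD[OF sk(2), of j i] by presburger
    then have su: "skew u" unfolding skew_def by blast
    have rsu: "reach V s u" using reach_trans s1(2) s2(1) ru by metis
    have pmu: "minors_agree V u t" using minors_agree_if_reach[OF ru s2(4)] pm2 minors_agree_sym minors_agree_trans by blast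
    have cX: "sclan V u X"
      unfolding sclan_def
    proof (intro conjI ballI)
      fix i j k assume "i \<in> X" "j \<in> X" "k \<in> V - X"
      moreover from this have "s2 i k = s2 j k" using s2(2) unfolding sclan_def by blast
      ultimately show "u i k = u j k" unfolding u_def by simp
    qed (rule XV)
    define Y where "Y = V - X"
    have Y0: "Y \<noteq> {}" using XV X2(1) unfolding Y_def by blast
    have inX: "\<not> dif u t i j" if "i \<in> X" "j \<in> X" for i j
      using that unfolding dif_def u_def by simp
    have inW: "\<not> dif u t i j" if "i \<in> W" "j \<in> W" for i j
      using that s2(3) unfolding dif_def u_def agree_def by auto
    have cl: "u p k = u q k" if "p \<in> X" "q \<in> X" "k \<in> Y" for p q k
      using cX that unfolding sclan_def Y_def by blast
    have dsym: "dif u t i j \<Longrightarrow> dif u t j i" for i j by (rule dif_sym[OF su sk(2)])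
    \<comment> \<open>By \<open>triangle\<close>, adding to \<open>X\<close> all vertices
      \<open>R\<close> reversed towards \<open>z\<close> gives a clan. It is strictly larger than
      \<open>X\<close>, so by maximality it is \<open>V\<close>: an element of \<open>X\<close> is
      reversed towards all of \<open>Y\<close> or towards none of it.\<close>
    have full: "dif u t z y" if z: "z \<in> X" "y' \<in> Y" "dif u t z y'" and y: "y \<in> Y" for z y y'
    proof -
      define R where "R = {y \<in> Y. dif u t z y}"
      have "sclan V u (X \<union> R)"
        unfolding sclan_def
      proof (intro conjI ballI)
        show "X \<union> R \<subseteq> V" using XV unfolding R_def Y_def by blast
        fix i j k assume ij: "i \<in> X \<union> R" "j \<in> X \<union> R" and k: "k \<in> V - (X \<union> R)"
        have kY: "k \<in> Y" "\<not> dif u t z k" using k unfolding R_def Y_def by auto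
        have "u i k = u z k" if "i \<in> X \<union> R" for i
        proof (cases "i \<in> X")
          case True then show ?thesis using cl z(1) kY by blast
        next
          case False
          then have i: "i \<in> Y" "dif u t z i" using that unfolding R_def by auto
          then have "\<not> dif u t i k" using inW[of i k] kY(1) unfolding W_def Y_def by blast
          then have "u z k = u i k"
            using triangle[OF su sk(2) pmu _ _ _ i(2) kY(2)] z(1) XV i(1) kY(1) unfolding Y_def by blast
          then show ?thesis by simp
        qed
        then show "u i k = u j k" using ij by metis
      qed
      moreover have "X \<union> R \<noteq> X" using z unfolding R_def Y_def by blast
      moreover have "card X \<le> card (X \<union> R)"
        using fin XV by (intro card_mono) (auto simp: R_def Y_def intro: finite_subset)
      ultimately have "X \<union> R = V"
        using X(2)[of "X \<union> R"] X2(2) su rsu unfolding Cl_def by fastforce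
      then show ?thesis using y unfolding R_def Y_def by blast
    qed
    define Z where "Z = {z \<in> X. \<exists>y\<in>Y. dif u t z y}"
    have ZX: "Z \<subseteq> X" unfolding Z_def by blast
    have ZY: "dif u t z y" if "z \<in> Z" "y \<in> Y" for z y using full that unfolding Z_def by blast
    have XZ: "\<not> dif u t p y" if "p \<in> X - Z" "y \<in> Y" for p y using that unfolding Z_def by blast
    \<comment> \<open>As \<open>x\<close> lies in \<open>W\<close>, no pair at \<open>x\<close> is
      reversed towards \<open>Y\<close>. Hence \<open>X - Z\<close> is nonempty, and
      \<open>x\<close> serves below as a reference point for showing that \<open>Y\<close> is a
      clan.\<close>
    have xZ: "x \<notin> Z" using inW[of x] unfolding Z_def W_def Y_def by blast
    have key: "u z p = u y p" if "z \<in> Z" "y \<in> Y" "p \<in> X - Z" for z y p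
    proof -
      have "\<not> dif u t z p" using inX ZX that by blast
      moreover have "\<not> dif u t y p" using XZ[of p y] dsym[of y p] that by blast
      ultimately show ?thesis
        using triangle[OF su sk(2) pmu, of z y p] ZY[of z y] that ZX XV unfolding Y_def by blast
    qed
    have rest: "k \<in> V - (Y \<union> Z) \<longleftrightarrow> k \<in> X - Z" for k using XV ZX unfolding Y_def by blast
    \<comment> \<open>For nonempty \<open>Z\<close>, \<open>key\<close> shows that all of
      \<open>Y \<union> Z\<close> looks the same from each point of \<open>X - Z\<close>. So
      \<open>Y\<close>, \<open>Z\<close> and \<open>Y \<union> Z\<close> are clans, and
      \<open>reach_swap\<close> reverses exactly the remaining pairs.\<close>
    have sw: "reach V u (\<lambda>i j. if i \<in> Y \<and> j \<in> Z \<or> i \<in> Z \<and> j \<in> Y then u j i else u i j)"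
    proof (cases "Z = {}")
      case True
      then show ?thesis by (intro reach.agree) (simp add: agree_def)
    next
      case False
      then obtain z0 where z0: "z0 \<in> Z" by blast
      obtain y0 where y0: "y0 \<in> Y" using Y0 by blast
      have both: "u i k = u y0 k" if "i \<in> Y \<union> Z" "k \<in> X - Z" for i k
        using key[of z0 i k] key[of z0 y0 k] key[of i y0 k] that z0 y0 by auto
      show ?thesis
      proof (rule reach_swap[OF su])
        show "sclan V u (Y \<union> Z)"
          unfolding sclan_def
        proof (intro conjI ballI)
          fix i j k assume "i \<in> Y \<union> Z" "j \<in> Y \<union> Z" "k \<in> V - (Y \<union> Z)"
          then show "u i k = u j k" using both[of i k] both[of j k] rest by simp
        qed (use ZX XV in \<open>auto simp: Y_def\<close>)
        show "sclan V u Z"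
          unfolding sclan_def
        proof (intro conjI ballI)
          fix i j k assume ij: "i \<in> Z" "j \<in> Z" and k: "k \<in> V - Z"
          show "u i k = u j k"
          proof (cases "k \<in> X")
            case True then show ?thesis using both[of i k] both[of j k] ij k by auto
          next
            case False then show ?thesis using cl[of i j k] ij k ZX unfolding Y_def by blast
          qed
        qed (use ZX XV in blast)
        show "sclan V u Y"
          unfolding sclan_def
        proof (intro conjI ballI)
          fix i j k assume ij: "i \<in> Y" "j \<in> Y" and k: "k \<in> V - Y"
          have "u i x = u j x" using both[of i x] both[of j x] ij x xZ by auto
          moreover have "k \<in> X" using k unfolding Y_def by blast
          ultimately show "u i k = u j k"
            using cl[of k x i] cl[of k x j] ij x skewD[OF su, of i k] skewD[OF su, of j k]
              skewD[OF su, of i x] skewD[OF su, of j x] by linarith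
        qed (auto simp: Y_def)
        show "Y \<inter> Z = {}" using ZX unfolding Y_def by blast
      qed
    qed
    have ag: "agree V (\<lambda>i j. if i \<in> Y \<and> j \<in> Z \<or> i \<in> Z \<and> j \<in> Y then u j i else u i j) t"
      unfolding agree_def
    proof (intro ballI)
      fix i j assume ij: "i \<in> V" "j \<in> V"
      show "(if i \<in> Y \<and> j \<in> Z \<or> i \<in> Z \<and> j \<in> Y then u j i else u i j) = t i j"
      proof (cases "i \<in> Y \<and> j \<in> Z \<or> i \<in> Z \<and> j \<in> Y")
        case True
        then have "dif u t i j" using ZY[of i j] ZY[of j i] dsym[of j i] by blast
        then have "t i j = - u i j" using dif_nonzero(2)[OF pmu ij] by blast
        then show ?thesis using True skewD[OF su, of j i] by simp
      next
        case False
        then have "\<not> dif u t i j"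
          using ij inX[of i j] inW[of i j] XZ[of i j] XZ[of j i] dsym[of i j] unfolding W_def Y_def by blast
        then show ?thesis using False unfolding dif_def by auto
      qed
    qed
    show ?thesis by (rule reach_trans[OF rsu reach_trans[OF sw reach.agree[OF ag]]])
  qed
qed

section \<open>Determinants\<close>

text \<open>The two enumerations differ by a permutation, whose sign enters once for the rows and
  once for the columns.\<close>

lemma det_reindex:
  fixes h :: "'b \<Rightarrow> 'b \<Rightarrow> 'a :: comm_ring_1"
  assumes f: "bij_betw f {..<n} Y" and g: "bij_betw g {..<n} Y"
  shows "det (mat n n (\<lambda>(i,j). h (g i) (g j))) = det (mat n n (\<lambda>(i,j). h (f i) (f j)))"
proof -
  define p where "p = (\<lambda>i. if i < n then inv_into {..<n} f (g i) else i)"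
  have fp: "f (p i) = g i" if "i < n" for i
  proof -
    have "g i \<in> f ` {..<n}" using that f g unfolding bij_betw_def by blast
    then show ?thesis using that by (simp add: p_def f_inv_into_f)
  qed
  have "bij_betw (inv_into {..<n} f \<circ> g) {..<n} {..<n}"
    using bij_betw_trans[OF g bij_betw_inv_into[OF f]] .
  then have "bij_betw p {..<n} {..<n}"
    by (rule bij_betw_cong[THEN iffD1, rotated]) (simp add: p_def)
  then have p: "p permutes {0..<n}"
    by (intro bij_imp_permutes) (auto simp: p_def atLeast0LessThan)
  have pn: "p i < n" if "i < n" for i using permutes_in_image[OF p, of i] that by simp
  have sq: "signof p * signof p = (1 :: 'a)" by (cases p rule: sign_cases) simp_all
  let ?A = "mat n n (\<lambda>(i,j). h (f i) (f j))"
  let ?B = "mat n n (\<lambda>(i,j). h (g i) (f j))"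
  let ?C = "mat n n (\<lambda>(i,j). h (g i) (g j))"
  have "?B = mat n n (\<lambda>(i,j). ?A $$ (p i, j))"
    by (rule eq_matI) (auto simp: fp pn)
  then have B: "det ?B = signof p * det ?A"
    using det_permute_rows[of ?A n p] p by simp
  have "?C\<^sup>T = mat n n (\<lambda>(i,j). ?B\<^sup>T $$ (p i, j))"
    by (rule eq_matI) (auto simp: fp pn)
  then have "det (?C\<^sup>T) = signof p * det (?B\<^sup>T)"
    using det_permute_rows[of "?B\<^sup>T" n p] p by simp
  then have "det ?C = signof p * det ?B"
    using det_transpose[of ?B n] det_transpose[of ?C n] by simp
  then show ?thesis using B sq by (simp add: mult.assoc[symmetric])
qed

lemma bij_betw_pick:
  assumes "finite X"
  shows "bij_betw (pick X) {..<card X} X"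
proof -
  have "inj_on (pick X) {..<card X}"
    by (rule inj_onI) (metis lessThan_iff linorder_neqE_nat nat_less_le pick_mono_le)
  moreover have "pick X ` {..<card X} \<subseteq> X" using pick_in_set_le by auto
  moreover have "card (pick X ` {..<card X}) = card X" using calculation(1) by (simp add: card_image)
  ultimately show ?thesis unfolding bij_betw_def using card_subset_eq[OF assms] by blast
qed

text \<open>Replaces the increasing enumeration built into \<open>submatrix\<close> by one adapted
  to a clan or to a given list.\<close>

lemma det_principal_submatrix:
  fixes M :: "'a :: comm_ring_1 mat"
  assumes M: "M \<in> carrier_mat n n" and X: "X \<subseteq> {..<n}" and f: "bij_betw f {..<card X} X"
  shows "det (principal_submatrix M X) = det (mat (card X) (card X) (\<lambda>(i,j). M $$ (f i, f j)))"
proof -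
  have "{i. i < n \<and> i \<in> X} = X" using X by auto
  then have "principal_submatrix M X = mat (card X) (card X) (\<lambda>(i,j). M $$ (pick X i, pick X j))"
    using M unfolding principal_submatrix_def submatrix_def by simp
  then show ?thesis
    using det_reindex[OF f bij_betw_pick, of "\<lambda>i j. M $$ (i,j)"] X finite_subset by auto
qed

text \<open>Multiplying from the left by a unipotent block matrix with lower left block
  \<open>- (Z * R)\<close> clears \<open>Z\<close> and leaves the Schur complement. As the rows of
  \<open>W\<close> are equal and so are the columns of \<open>Z\<close>, the matrix \<open>R\<close>
  enters it only through the sum of its entries.\<close>

lemma det_schur_rank_one:
  fixes P :: "'a :: field mat"
  assumes P: "P \<in> carrier_mat r r" and R: "R \<in> carrier_mat r r" "R * P = 1\<^sub>m r"
    and Q: "Q \<in> carrier_mat m m"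
  shows "det (four_block_mat P (mat r m (\<lambda>(i,j). w j)) (mat m r (\<lambda>(i,j). z i)) Q) =
    det P * det (mat m m (\<lambda>(i,j). Q $$ (i,j) - (\<Sum>k<r. \<Sum>l<r. R $$ (k,l)) * z i * w j))"
proof -
  define W where "W = mat r m (\<lambda>(i::nat,j). w j)"
  define Z where "Z = mat m r (\<lambda>(i,j::nat). z i)"
  have WZ: "W \<in> carrier_mat r m" "Z \<in> carrier_mat m r" unfolding W_def Z_def by auto
  define K where "K = - (Z * R)"
  have K: "K \<in> carrier_mat m r" unfolding K_def using WZ R by auto
  let ?L = "four_block_mat (1\<^sub>m r) (0\<^sub>m r m) K (1\<^sub>m m)"
  let ?S = "mat m m (\<lambda>(i,j). Q $$ (i,j) - (\<Sum>k<r. \<Sum>l<r. R $$ (k,l)) * z i * w j)"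
  have KP: "K * P + Z = 0\<^sub>m m r"
  proof -
    have "K * P = - (Z * (R * P))" unfolding K_def using WZ R(1) P by simp
    also have "\<dots> = - Z" unfolding R(2) using WZ by simp
    finally show ?thesis using WZ by simp
  qed
  have KW: "K * W + Q = ?S"
  proof (rule eq_matI)
    fix i j assume ij: "i < dim_row ?S" "j < dim_col ?S"
    then have ij': "i < m" "j < m" by auto
    have "(Z * R) $$ (i,l) = (\<Sum>k<r. z i * R $$ (k,l))" if "l < r" for l
      using that ij' WZ R(1) by (simp add: Z_def scalar_prod_def atLeast0LessThan)
    then have "K $$ (i,l) = - (\<Sum>k<r. z i * R $$ (k,l))" if "l < r" for l
      using that ij' WZ R(1) unfolding K_def by simp
    then have "(K * W) $$ (i,j) = (\<Sum>l<r. - (\<Sum>k<r. z i * R $$ (k,l)) * w j)"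
      using ij' WZ K by (simp add: W_def scalar_prod_def atLeast0LessThan)
    also have "\<dots> = - (\<Sum>l<r. \<Sum>k<r. R $$ (k,l)) * z i * w j"
      by (simp add: sum_distrib_left sum_distrib_right sum_negf mult_ac)
    also have "(\<Sum>l<r. \<Sum>k<r. R $$ (k,l)) = (\<Sum>k<r. \<Sum>l<r. R $$ (k,l))" by (rule sum.swap)
    finally show "(K * W + Q) $$ (i,j) = ?S $$ (i,j)" using ij' K WZ Q by simp
  qed (use K WZ Q in auto)
  have "?L * four_block_mat P W Z Q = four_block_mat P W (0\<^sub>m m r) ?S"
    by (subst mult_four_block_mat[of _ r r _ m _ m _ _ r _ m])
       (use P Q WZ K KP KW in auto)
  moreover have "det ?L = 1"
    by (subst det_four_block_mat_upper_right_zero[of _ r _ m]) (use K in auto)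
  moreover have "det (?L * four_block_mat P W Z Q) = det ?L * det (four_block_mat P W Z Q)"
    by (rule det_mult[of _ "r + m"]) (use P Q K in auto)
  moreover have "det (four_block_mat P W (0\<^sub>m m r) ?S) = det P * det ?S"
    by (rule det_four_block_mat_lower_left_zero[of _ r _ m]) (use P WZ in auto)
  ultimately show ?thesis unfolding W_def Z_def by simp
qed

text \<open>Transposing the block changes neither its determinant nor the sum of the entries of its
  inverse, the only data of the block in \<open>det_schur_rank_one\<close>.\<close>

lemma det_block_transpose_invertible:
  fixes a :: "nat \<Rightarrow> nat \<Rightarrow> 'a :: field"
  assumes w: "\<And>i j. i < r \<Longrightarrow> r \<le> j \<Longrightarrow> j < r + m \<Longrightarrow> a i j = w j"
    and z: "\<And>i j. i < r \<Longrightarrow> r \<le> j \<Longrightarrow> j < r + m \<Longrightarrow> a j i = z j"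
    and inv: "det (mat r r (\<lambda>(i,j). a i j)) \<noteq> 0"
  shows "det (mat (r + m) (r + m) (\<lambda>(i,j). if i < r \<and> j < r then a j i else a i j)) =
    det (mat (r + m) (r + m) (\<lambda>(i,j). a i j))"
proof -
  define P where "P = mat r r (\<lambda>(i,j). a i j)"
  define Q where "Q = mat m m (\<lambda>(i,j). a (r + i) (r + j))"
  have P: "P \<in> carrier_mat r r" and Q: "Q \<in> carrier_mat m m" unfolding P_def Q_def by auto
  define R where "R = inverse (det P) \<cdot>\<^sub>m adj_mat P"
  have R: "R \<in> carrier_mat r r" unfolding R_def using adj_mat(1)[OF P] by simp
  have one: "inverse (det P) \<cdot>\<^sub>m (det P \<cdot>\<^sub>m 1\<^sub>m r) = 1\<^sub>m r"
    by (rule eq_matI) (use inv[folded P_def] in auto)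
  have RP: "R * P = 1\<^sub>m r"
    unfolding R_def mult_smult_assoc_mat[OF adj_mat(1)[OF P] P] adj_mat(3)[OF P] one ..
  have PR: "P * R = 1\<^sub>m r"
    unfolding R_def mult_smult_distrib[OF P adj_mat(1)[OF P]] adj_mat(2)[OF P] one ..
  have "R\<^sup>T * P\<^sup>T = (P * R)\<^sup>T" using P R by (simp add: transpose_mult)
  then have RPT: "R\<^sup>T * P\<^sup>T = 1\<^sub>m r" using PR by simp
  let ?W = "mat r m (\<lambda>(i,j). w (r + j))" and ?Z = "mat m r (\<lambda>(i,j). z (r + i))"
  have 1: "mat (r + m) (r + m) (\<lambda>(i,j). a i j) = four_block_mat P ?W ?Z Q"
    by (rule eq_matI) (auto simp: P_def Q_def w z)
  have 2: "mat (r + m) (r + m) (\<lambda>(i,j). if i < r \<and> j < r then a j i else a i j) = four_block_mat (P\<^sup>T) ?W ?Z Q"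
    by (rule eq_matI) (auto simp: P_def Q_def w z)
  have "(\<Sum>k<r. \<Sum>l<r. R\<^sup>T $$ (k,l)) = (\<Sum>k<r. \<Sum>l<r. R $$ (l,k))"
    using R by (intro sum.cong) auto
  also have "\<dots> = (\<Sum>k<r. \<Sum>l<r. R $$ (k,l))" by (rule sum.swap)
  finally have s: "(\<Sum>k<r. \<Sum>l<r. R\<^sup>T $$ (k,l)) = (\<Sum>k<r. \<Sum>l<r. R $$ (k,l))" .
  have PT: "P\<^sup>T \<in> carrier_mat r r" "R\<^sup>T \<in> carrier_mat r r" using P R by auto
  show ?thesis
    unfolding 1 2 det_schur_rank_one[OF P R RP Q] det_schur_rank_one[OF PT RPT Q] s det_transpose[OF P] ..
qed

text \<open>The entries are negated because the characteristic polynomial of \<open>A\<close> at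
  \<open>x\<close> is the determinant of \<open>x\<close> times the identity minus
  \<open>A\<close>.\<close>

lemma poly_char_poly_neg_mat:
  fixes a :: "nat \<Rightarrow> nat \<Rightarrow> 'a :: field"
  shows "poly (char_poly (mat n n (\<lambda>(i,j). - a i j))) x =
    det (mat n n (\<lambda>(i,j). a i j + (if i = j then x else 0)))"
proof -
  let ?A = "mat n n (\<lambda>(i,j). - a i j)"
  have "- (char_matrix ?A x) = mat n n (\<lambda>(i,j). a i j + (if i = j then x else 0))"
    unfolding char_matrix_def by (rule eq_matI) auto
  then show ?thesis using char_poly_matrix[of ?A n x] by simp
qed

text \<open>Adding \<open>x\<close> to the diagonal makes the block invertible for all but finitely many \<open>x\<close>.\<close>

lemma det_block_transpose:
  fixes a :: "nat \<Rightarrow> nat \<Rightarrow> 'a :: field_char_0"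
  assumes w: "\<And>i j. i < r \<Longrightarrow> r \<le> j \<Longrightarrow> j < r + m \<Longrightarrow> a i j = w j"
    and z: "\<And>i j. i < r \<Longrightarrow> r \<le> j \<Longrightarrow> j < r + m \<Longrightarrow> a j i = z j"
  shows "det (mat (r + m) (r + m) (\<lambda>(i,j). if i < r \<and> j < r then a j i else a i j)) =
    det (mat (r + m) (r + m) (\<lambda>(i,j). a i j))"
proof -
  define a' where "a' = (\<lambda>i j. if i < r \<and> j < r then a j i else a i j)"
  define p where "p = char_poly (mat (r + m) (r + m) (\<lambda>(i,j). - a i j))"
  define p' where "p' = char_poly (mat (r + m) (r + m) (\<lambda>(i,j). - a' i j))"
  define q where "q = char_poly (mat r r (\<lambda>(i,j). - a i j))"
  have "q \<noteq> 0"
  proof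
    assume "q = 0"
    then have "coeff q r = 0" by simp
    moreover have "coeff q r = 1"
      unfolding q_def using degree_monic_char_poly[of "mat r r (\<lambda>(i,j). - a i j)" r] by simp
    ultimately show False by simp
  qed
  have "poly p' x = poly p x" if "poly q x \<noteq> 0" for x
  proof -
    let ?b = "\<lambda>i j. a i j + (if i = j then x else 0)"
    have "det (mat (r + m) (r + m) (\<lambda>(i,j). if i < r \<and> j < r then ?b j i else ?b i j)) =
      det (mat (r + m) (r + m) (\<lambda>(i,j). ?b i j))"
      by (rule det_block_transpose_invertible[where w = w and z = z])
         (use w z that in \<open>auto simp: q_def poly_char_poly_neg_mat\<close>)
    moreover have "(\<lambda>(i,j). if i < r \<and> j < r then ?b j i else ?b i j) =
      (\<lambda>(i,j). a' i j + (if i = j then x else 0))"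
      unfolding a'_def by auto
    ultimately show ?thesis unfolding p_def p'_def poly_char_poly_neg_mat by simp
  qed
  \<comment> \<open>Multiplying by \<open>q\<close> absorbs its roots. The field is infinite, so the
    product is the zero polynomial; evaluating \<open>p' = p\<close> at 0 removes the
    perturbation.\<close>
  then have "poly ((p' - p) * q) x = 0" for x by (cases "poly q x = 0") auto
  then have "(p' - p) * q = 0" using poly_all_0_iff_0 by blast
  then have "p' = p" using \<open>q \<noteq> 0\<close> by simp
  then have "poly p' 0 = poly p 0" by simp
  then show ?thesis unfolding p_def p'_def poly_char_poly_neg_mat a'_def by simp
qed

section \<open>Clan inversion preserves principal minors\<close>

lemma is_clan_col: "is_clan n M X \<Longrightarrow> i \<in> X \<Longrightarrow> j \<in> X \<Longrightarrow> k < n \<Longrightarrow> k \<notin> X \<Longrightarrow> M $$ (i,k) = M $$ (j,k)"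
  unfolding is_clan_def by blast

lemma is_clan_row: "is_clan n M X \<Longrightarrow> i \<in> X \<Longrightarrow> j \<in> X \<Longrightarrow> k < n \<Longrightarrow> k \<notin> X \<Longrightarrow> M $$ (k,i) = M $$ (k,j)"
  unfolding is_clan_def by blast

theorem det_principal_submatrix_Inv:
  fixes M :: "'a :: field_char_0 mat"
  assumes M: "M \<in> carrier_mat n n" and cl: "is_clan n M X" and Y: "Y \<subseteq> {..<n}"
  shows "det (principal_submatrix (Inv M X) Y) = det (principal_submatrix M Y)"
proof -
  have fin: "finite Y" using Y finite_subset by blast
  define r m where "r = card (Y \<inter> X)" and "m = card (Y - X)"
  obtain f where f: "bij_betw f {..<r} (Y \<inter> X)"
    using ex_bij_betw_nat_finite[of "Y \<inter> X"] fin unfolding r_def by (auto simp: atLeast0LessThan)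
  obtain g where g: "bij_betw g {..<m} (Y - X)"
    using ex_bij_betw_nat_finite[of "Y - X"] fin unfolding m_def by (auto simp: atLeast0LessThan)
  \<comment> \<open>This enumeration lists \<open>Y \<inter> X\<close> first, so the inversion
    becomes the transposition of the leading block.\<close>
  define e where "e = (\<lambda>i. if i < r then f i else g (i - r))"
  have e1: "bij_betw e {..<r} (Y \<inter> X)"
    using f by (rule bij_betw_cong[THEN iffD1, rotated]) (simp add: e_def)
  have "bij_betw (\<lambda>i. i - r) {r..<r + m} {..<m}"
    by (rule bij_betw_byWitness[where f' = "\<lambda>i. i + r"]) auto
  from bij_betw_trans[OF this g] have e2: "bij_betw e {r..<r + m} (Y - X)"
    by (rule bij_betw_cong[THEN iffD1, rotated]) (simp add: e_def)
  have "bij_betw e ({..<r} \<union> {r..<r + m}) ((Y \<inter> X) \<union> (Y - X))"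
    by (rule bij_betw_combine[OF e1 e2]) blast
  moreover have "{..<r} \<union> {r..<r + m} = {..<r + m}" by auto
  moreover have "(Y \<inter> X) \<union> (Y - X) = Y" by blast
  moreover have cY: "card Y = r + m"
    unfolding r_def m_def using card_Int_Diff[OF fin] by simp
  ultimately have e: "bij_betw e {..<card Y} Y" by simp
  have eX: "e i \<in> X \<longleftrightarrow> i < r" if "i < r + m" for i
    using that e1 e2 unfolding bij_betw_def by (cases "i < r") force+
  have en: "e i < n" if "i < r + m" for i using that e Y cY unfolding bij_betw_def by auto
  have I: "Inv M X \<in> carrier_mat n n" using M unfolding Inv_def by auto
  have "mat (r + m) (r + m) (\<lambda>(i,j). Inv M X $$ (e i, e j)) =
    mat (r + m) (r + m) (\<lambda>(i,j). if i < r \<and> j < r then M $$ (e j, e i) else M $$ (e i, e j))"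
    by (rule eq_matI) (use M en eX in \<open>auto simp: Inv_def\<close>)
  moreover have "det \<dots> = det (mat (r + m) (r + m) (\<lambda>(i,j). M $$ (e i, e j)))"
  \<comment> \<open>\<open>e 0\<close> represents the clan; whenever the required equations have an
    index \<open>i < r\<close>, also \<open>0 < r\<close> and \<open>e 0\<close> lies in
    \<open>X\<close>.\<close>
  proof (rule det_block_transpose[where w = "\<lambda>j. M $$ (e 0, e j)" and z = "\<lambda>j. M $$ (e j, e 0)"])
    fix i j assume "i < r" "r \<le> j" "j < r + m"
    then show "M $$ (e i, e j) = M $$ (e 0, e j)" "M $$ (e j, e i) = M $$ (e j, e 0)"
      using is_clan_col[OF cl, of "e i" "e 0" "e j"] is_clan_row[OF cl, of "e i" "e 0" "e j"] eX en by auto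
  qed
  ultimately show ?thesis
    unfolding det_principal_submatrix[OF I Y e] det_principal_submatrix[OF M Y e] cY by simp
qed

section \<open>Generalized tournament matrices\<close>

text \<open>Laplace expansion along row 0; the conditional column index skips column
  \<open>j\<close>. Iterating it yields the explicit formulas up to order 4.\<close>

lemma det_mat_Suc:
  fixes a :: "nat \<Rightarrow> nat \<Rightarrow> 'a :: comm_ring_1"
  shows "det (mat (Suc n) (Suc n) (\<lambda>(i,j). a i j)) =
    (\<Sum>j<Suc n. (-1) ^ j * a 0 j * det (mat n n (\<lambda>(i,k). a (Suc i) (if k < j then k else Suc k))))"
proof -
  let ?A = "mat (Suc n) (Suc n) (\<lambda>(i,j). a i j)"
  have "mat_delete ?A 0 j = mat n n (\<lambda>(i,k). a (Suc i) (if k < j then k else Suc k))" for j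
    unfolding mat_delete_def by (rule eq_matI) auto
  then have "?A $$ (0,j) * cofactor ?A 0 j =
      (-1) ^ j * a 0 j * det (mat n n (\<lambda>(i,k). a (Suc i) (if k < j then k else Suc k)))"
    if "j < Suc n" for j
    using that unfolding cofactor_def by (simp add: mult_ac)
  then show ?thesis using laplace_expansion_row[of ?A "Suc n" 0] by simp
qed

lemma det_mat_0: "det (mat 0 0 f) = 1"
  by (rule det_dim_zero) simp

lemma det_mat_2:
  fixes a :: "nat \<Rightarrow> nat \<Rightarrow> 'a :: comm_ring_1"
  shows "det (mat 2 2 (\<lambda>(i,j). a i j)) = a 0 0 * a 1 1 - a 0 1 * a 1 0"
  unfolding numeral_2_eq_2 by (simp add: det_mat_Suc det_mat_0)

lemma det_mat_3:
  fixes a :: "nat \<Rightarrow> nat \<Rightarrow> 'a :: comm_ring_1"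
  shows "det (mat 3 3 (\<lambda>(i,j). a i j)) =
    a 0 0 * (a 1 1 * a 2 2 - a 1 2 * a 2 1) - a 0 1 * (a 1 0 * a 2 2 - a 1 2 * a 2 0)
    + a 0 2 * (a 1 0 * a 2 1 - a 1 1 * a 2 0)"
proof -
  show ?thesis
    unfolding numeral_3_eq_3 numeral_2_eq_2[symmetric] det_mat_Suc det_mat_2
    by (simp add: numeral_2_eq_2)
qed

lemma det_mat_4:
  fixes a :: "nat \<Rightarrow> nat \<Rightarrow> 'a :: comm_ring_1"
  shows "det (mat 4 4 (\<lambda>(i,j). a i j)) =
    a 0 0 * (a 1 1 * (a 2 2 * a 3 3 - a 2 3 * a 3 2) - a 1 2 * (a 2 1 * a 3 3 - a 2 3 * a 3 1)
      + a 1 3 * (a 2 1 * a 3 2 - a 2 2 * a 3 1))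
    - a 0 1 * (a 1 0 * (a 2 2 * a 3 3 - a 2 3 * a 3 2) - a 1 2 * (a 2 0 * a 3 3 - a 2 3 * a 3 0)
      + a 1 3 * (a 2 0 * a 3 2 - a 2 2 * a 3 0))
    + a 0 2 * (a 1 0 * (a 2 1 * a 3 3 - a 2 3 * a 3 1) - a 1 1 * (a 2 0 * a 3 3 - a 2 3 * a 3 0)
      + a 1 3 * (a 2 0 * a 3 1 - a 2 1 * a 3 0))
    - a 0 3 * (a 1 0 * (a 2 1 * a 3 2 - a 2 2 * a 3 1) - a 1 1 * (a 2 0 * a 3 2 - a 2 2 * a 3 0)
      + a 1 2 * (a 2 0 * a 3 1 - a 2 1 * a 3 0))"
proof -
  have 4: "(4::nat) = Suc 3" by simp
  show ?thesis
    unfolding 4 det_mat_Suc det_mat_3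
    by (simp add: numeral_2_eq_2 numeral_3_eq_3)
qed

text \<open>Off the diagonal of a generalized tournament matrix an entry is half of one plus its
  skew part, so the skew part determines the matrix.\<close>

definition skew_part :: "real mat \<Rightarrow> nat \<Rightarrow> nat \<Rightarrow> real" where
  "skew_part M i j = M $$ (i,j) - M $$ (j,i)"

lemma skew_skew_part: "skew (skew_part M)"
  unfolding skew_def skew_part_def by simp

lemma gen_tournament_iff:
  "gen_tournament n M \<longleftrightarrow> M \<in> carrier_mat n n \<and>
     (\<forall>i<n. \<forall>j<n. M $$ (i,j) \<ge> 0 \<and> M $$ (i,j) + M $$ (j,i) = (if i = j then 0 else 1))"
proof (cases "M \<in> carrier_mat n n")
  case True
  have "M + M\<^sup>T = mat n n (\<lambda>_. 1) - 1\<^sub>m n \<longleftrightarrow>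
    (\<forall>i<n. \<forall>j<n. M $$ (i,j) + M $$ (j,i) = (if i = j then 0 else 1))"
  proof
    assume eq: "M + M\<^sup>T = mat n n (\<lambda>_. 1) - 1\<^sub>m n"
    show "\<forall>i<n. \<forall>j<n. M $$ (i,j) + M $$ (j,i) = (if i = j then 0 else 1)"
    proof (intro allI impI)
      fix i j assume "i < n" "j < n"
      then show "M $$ (i,j) + M $$ (j,i) = (if i = j then 0 else 1)"
        using arg_cong[OF eq, of "\<lambda>A. A $$ (i,j)"] True by auto
    qed
  next
    assume "\<forall>i<n. \<forall>j<n. M $$ (i,j) + M $$ (j,i) = (if i = j then 0 else 1)"
    then show "M + M\<^sup>T = mat n n (\<lambda>_. 1) - 1\<^sub>m n" using True by (intro eq_matI) auto
  qed
  then show ?thesis unfolding gen_tournament_def by blast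
qed (simp add: gen_tournament_def)

lemma gen_tournament_entry:
  assumes "gen_tournament n M" "i < n" "j < n"
  shows "M $$ (i,j) = (if i = j then 0 else (1 + skew_part M i j) / 2)"
proof -
  have "M $$ (i,j) + M $$ (j,i) = (if i = j then 0 else 1)"
    using assms unfolding gen_tournament_iff by blast
  then show ?thesis unfolding skew_part_def by (auto simp: field_simps)
qed

lemma det_principal_submatrix_list:
  fixes M :: "'a :: comm_ring_1 mat"
  assumes "M \<in> carrier_mat n n" "distinct xs" "set xs \<subseteq> {..<n}"
  shows "det (principal_submatrix M (set xs)) =
    det (mat (length xs) (length xs) (\<lambda>(p,q). M $$ (xs ! p, xs ! q)))"
  using det_principal_submatrix[OF assms(1,3), of "(!) xs"] bij_betw_nth[OF assms(2) refl refl]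
    distinct_card[OF assms(2)] by simp

lemma minor_2:
  assumes M: "gen_tournament n M" and d: "distinct [i,j]" "set [i,j] \<subseteq> {..<n}"
  shows "det (principal_submatrix M (set [i,j])) = ((skew_part M i j)\<^sup>2 - 1) / 4"
proof -
  have C: "M \<in> carrier_mat n n" using M unfolding gen_tournament_def by blast
  have j: "skew_part M j i = - skew_part M i j" by (rule skewD[OF skew_skew_part])
  show ?thesis
    unfolding det_principal_submatrix_list[OF C d]
    using d by (simp add: det_mat_2[unfolded numeral_2_eq_2] gen_tournament_entry[OF M] j
        power2_eq_square field_simps)
qed

text \<open>The diagonal vanishes, so only the two cyclic products remain. In their sum the terms of
  odd degree cancel, and the mixed products are rewritten through the squared cyclic sum.\<close>

lemma minor_3:
  assumes M: "gen_tournament n M" and d: "distinct [i,j,k]" "set [i,j,k] \<subseteq> {..<n}"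
  defines "s \<equiv> skew_part M"
  shows "det (principal_submatrix M (set [i,j,k])) =
    (2 + (s i j + s j k + s k i)\<^sup>2 - (s i j)\<^sup>2 - (s j k)\<^sup>2 - (s k i)\<^sup>2) / 8"
proof -
  have C: "M \<in> carrier_mat n n" using M unfolding gen_tournament_def by blast
  have j: "s j i = - s i j" "s k j = - s j k" "s i k = - s k i"
    unfolding s_def by (rule skewD[OF skew_skew_part])+
  let ?xs = "[i,j,k]"
  have "det (mat 3 3 (\<lambda>(p,q). M $$ (?xs ! p, ?xs ! q))) =
    M $$ (i,j) * M $$ (j,k) * M $$ (k,i) + M $$ (i,k) * M $$ (k,j) * M $$ (j,i)"
    unfolding det_mat_3 using d by (simp add: gen_tournament_entry[OF M, of i i]
      gen_tournament_entry[OF M, of j j] gen_tournament_entry[OF M, of k k])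
  also have "\<dots> = (1 + s i j) / 2 * ((1 + s j k) / 2) * ((1 + s k i) / 2)
      + (1 - s k i) / 2 * ((1 - s j k) / 2) * ((1 - s i j) / 2)"
    using d gen_tournament_entry[OF M, folded s_def] by (auto simp: j)
  also have "\<dots> = (2 + (s i j + s j k + s k i)\<^sup>2 - (s i j)\<^sup>2 - (s j k)\<^sup>2 - (s k i)\<^sup>2) / 8"
    by (simp add: power2_eq_square field_simps)
  finally show ?thesis
    unfolding det_principal_submatrix_list[OF C d] by (simp add: numeral_3_eq_3)
qed

text \<open>All terms but the last are functions of squared entries and squared cyclic sums. Once
  these agree for two matrices, equal minors of order 4 force equal squared Pfaffians.\<close>

lemma minor_4:
  assumes M: "gen_tournament n M" and d: "distinct [i,j,k,l]" "set [i,j,k,l] \<subseteq> {..<n}"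
  defines "s \<equiv> skew_part M"
  defines "tri \<equiv> \<lambda>x y z. (s x y + s y z + s z x)\<^sup>2 - (s x y)\<^sup>2 - (s y z)\<^sup>2 - (s z x)\<^sup>2"
  shows "16 * det (principal_submatrix M (set [i,j,k,l])) =
    (1 - (s i j)\<^sup>2) * (1 - (s k l)\<^sup>2) + (1 - (s i k)\<^sup>2) * (1 - (s j l)\<^sup>2)
    + (1 - (s i l)\<^sup>2) * (1 - (s j k)\<^sup>2) - 6 - tri i j k - tri i j l - tri i k l - tri j k l
    - (s i j)\<^sup>2 * (s k l)\<^sup>2 - (s i k)\<^sup>2 * (s j l)\<^sup>2 - (s i l)\<^sup>2 * (s j k)\<^sup>2 + (pfaff s i j k l)\<^sup>2"
proof -
  have C: "M \<in> carrier_mat n n" using M unfolding gen_tournament_def by blast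
  define a b c d' e f where "a = s i j" and "b = s i k" and "c = s i l"
    and "d' = s j k" and "e = s j l" and "f = s k l"
  note df = a_def b_def c_def d'_def e_def f_def
  have m: "s j i = - a" "s k i = - b" "s l i = - c" "s k j = - d'" "s l j = - e" "s l k = - f"
    unfolding s_def df by (rule skewD[OF skew_skew_part])+
  let ?xs = "[i,j,k,l]"
  have E: "M $$ (i,i) = 0" "M $$ (j,j) = 0" "M $$ (k,k) = 0" "M $$ (l,l) = 0"
    "M $$ (i,j) = (1 + a) / 2" "M $$ (i,k) = (1 + b) / 2" "M $$ (i,l) = (1 + c) / 2"
    "M $$ (j,k) = (1 + d') / 2" "M $$ (j,l) = (1 + e) / 2" "M $$ (k,l) = (1 + f) / 2"
    "M $$ (j,i) = (1 - a) / 2" "M $$ (k,i) = (1 - b) / 2" "M $$ (l,i) = (1 - c) / 2"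
    "M $$ (k,j) = (1 - d') / 2" "M $$ (l,j) = (1 - e) / 2" "M $$ (l,k) = (1 - f) / 2"
    using d gen_tournament_entry[OF M, folded s_def] m df by auto
  have D: "det (principal_submatrix M (set ?xs)) = det (mat 4 4 (\<lambda>(p,q). M $$ (?xs ! p, ?xs ! q)))"
    unfolding det_principal_submatrix_list[OF C d] by (simp add: numeral_Bit0)
  have nth: "?xs ! 0 = i" "?xs ! 1 = j" "?xs ! 2 = k" "?xs ! 3 = l" by simp_all
  show ?thesis
    unfolding D det_mat_4 nth E tri_def pfaff_def m df[symmetric]
    by (simp add: power2_eq_square field_simps)
qed

text \<open>Orders 2, 3 and 4 are used in turn, each isolating one new invariant. For repeated
  indices the cyclic sums and Pfaffians are zero on both sides.\<close>

lemma minors_agree_if_small_minors_eq: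
  assumes A: "gen_tournament n A" and B: "gen_tournament n B"
    and min: "\<forall>X. X \<subseteq> {..<n} \<and> 1 \<le> card X \<and> card X \<le> 4 \<longrightarrow>
      det (principal_submatrix A X) = det (principal_submatrix B X)"
  shows "minors_agree {..<n} (skew_part A) (skew_part B)"
proof -
  let ?s = "skew_part A" and ?t = "skew_part B"
  have minor: "det (principal_submatrix A (set xs)) = det (principal_submatrix B (set xs))"
    if "distinct xs" "set xs \<subseteq> {..<n}" "xs \<noteq> []" "length xs \<le> 4" for xs
    using min that distinct_card[OF that(1)] by (metis One_nat_def Suc_leI length_greater_0_conv)
  have s0: "?s i i = 0" "?t i i = 0" for i by (simp_all add: skew_part_def)
  have c2: "(?s i j)\<^sup>2 = (?t i j)\<^sup>2" if "i < n" "j < n" for i j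
  proof (cases "i = j")
    case False
    then have d: "distinct [i,j]" "set [i,j] \<subseteq> {..<n}" using that by auto
    show ?thesis using minor[OF d] minor_2[OF A d] minor_2[OF B d] by simp
  qed (simp add: s0)
  have c3: "(?s i j + ?s j k + ?s k i)\<^sup>2 = (?t i j + ?t j k + ?t k i)\<^sup>2"
    if "i < n" "j < n" "k < n" for i j k
  proof (cases "distinct [i,j,k]")
    case True
    then have d: "distinct [i,j,k]" "set [i,j,k] \<subseteq> {..<n}" using that by auto
    show ?thesis
      using minor[OF d] minor_3[OF A d] minor_3[OF B d] c2 that by simp
  next
    case False
    then show ?thesis by (auto simp: skew_part_def)
  qed
  have c4: "(pfaff ?s i j k l)\<^sup>2 = (pfaff ?t i j k l)\<^sup>2"
    if "i < n" "j < n" "k < n" "l < n" for i j k l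
  proof (cases "distinct [i,j,k,l]")
    case True
    then have d: "distinct [i,j,k,l]" "set [i,j,k,l] \<subseteq> {..<n}" using that by auto
    have "16 * det (principal_submatrix A (set [i,j,k,l])) = 16 * det (principal_submatrix B (set [i,j,k,l]))"
      using minor[OF d] by simp
    then show ?thesis
      unfolding minor_4[OF A d] minor_4[OF B d] using that by (simp add: c2 c3)
  next
    case False
    then have "pfaff ?s i j k l = 0" "pfaff ?t i j k l = 0"
      by (auto simp: pfaff_def skew_part_def algebra_simps)
    then show ?thesis by simp
  qed
  show ?thesis unfolding minors_agree_def using c2 c3 c4 by simp
qed

section \<open>From skew functions back to matrices\<close>

lemma gen_tournament_Inv:
  assumes "gen_tournament n M" shows "gen_tournament n (Inv M X)"
proof -
  have M: "M \<in> carrier_mat n n" using assms unfolding gen_tournament_def by blast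
  have e: "M $$ (i,j) \<ge> 0 \<and> M $$ (i,j) + M $$ (j,i) = (if i = j then 0 else 1)" if "i < n" "j < n" for i j
    using assms that unfolding gen_tournament_iff by blast
  have I: "Inv M X $$ (i,j) = (if i \<in> X \<and> j \<in> X then M $$ (j,i) else M $$ (i,j))"
    if "i < n" "j < n" for i j
    using M that unfolding Inv_def by auto
  have "Inv M X $$ (i,j) \<ge> 0 \<and> Inv M X $$ (i,j) + Inv M X $$ (j,i) = (if i = j then 0 else 1)"
    if "i < n" "j < n" for i j
    unfolding I[OF that] I[OF that(2,1)] using e[OF that] e[OF that(2,1)] by presburger
  moreover have "Inv M X \<in> carrier_mat n n" using M unfolding Inv_def by auto
  ultimately show ?thesis unfolding gen_tournament_iff by blast
qed

lemma skew_part_Inv: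
  assumes "gen_tournament n M" shows "agree {..<n} (skew_part (Inv M X)) (flip X (skew_part M))"
  using assms unfolding gen_tournament_def agree_def skew_part_def flip_def Inv_def by auto

text \<open>The clan equations compare only entries off the diagonal, where the skew part determines
  the entry uniformly.\<close>

lemma is_clan_if_sclan:
  assumes M: "gen_tournament n M" and cl: "sclan {..<n} (skew_part M) X"
  shows "is_clan n M X"
  unfolding is_clan_def
proof (intro conjI ballI)
  show "X \<subseteq> {..<n}" using cl unfolding sclan_def by blast
  fix i j k assume ij: "i \<in> X" "j \<in> X" and k: "k \<in> {..<n} - X"
  have "i < n" "j < n" "k < n" "i \<noteq> k" "j \<noteq> k" using ij k cl unfolding sclan_def by auto
  moreover have "skew_part M i k = skew_part M j k" using cl ij k unfolding sclan_def by blast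
  moreover from this have "skew_part M k i = skew_part M k j" unfolding skew_part_def by linarith
  ultimately show "M $$ (i,k) = M $$ (j,k)" "M $$ (k,i) = M $$ (k,j)"
    using gen_tournament_entry[OF M] by auto
qed

lemma eq_if_skew_part_agree:
  assumes "gen_tournament n A" "gen_tournament n B" "agree {..<n} (skew_part A) (skew_part B)"
  shows "A = B"
proof (rule eq_matI)
  have C: "A \<in> carrier_mat n n" "B \<in> carrier_mat n n" using assms unfolding gen_tournament_def by auto
  then show "dim_row A = dim_row B" "dim_col A = dim_col B" by auto
  fix i j assume "i < dim_row B" "j < dim_col B"
  then have "i < n" "j < n" using C by auto
  then show "A $$ (i,j) = B $$ (i,j)"
    using gen_tournament_entry[OF assms(1)] gen_tournament_entry[OF assms(2)] assms(3)
    unfolding agree_def by simp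
qed

lemma clan_sequence_if_reach:
  assumes "reach {..<n} s t" "gen_tournament n A" "gen_tournament n B"
    and "agree {..<n} (skew_part A) s" "agree {..<n} (skew_part B) t"
  shows "\<exists>(m::nat) As Xs. As 0 = A \<and> As m = B \<and> (\<forall>k\<le>m. gen_tournament n (As k)) \<and>
    (\<forall>k<m. is_clan n (As k) (Xs k) \<and> As (Suc k) = Inv (As k) (Xs k))"
  using assms
proof (induction arbitrary: A rule: reach.induct)
  case (agree s t)
  then have "agree {..<n} (skew_part A) (skew_part B)" unfolding agree_def by simp
  then have "A = B" using eq_if_skew_part_agree agree.prems by blast
  then show ?case using agree.prems by (intro exI[of _ 0] exI[of _ "\<lambda>_. A"]) auto
next
  case (step s X t)
  have clan: "is_clan n A X"
    by (rule is_clan_if_sclan[OF step.prems(1) agree_sclan[OF step.prems(3) step.hyps(1)]])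
  have ag: "agree {..<n} (skew_part (Inv A X)) (flip X s)"
    using skew_part_Inv[OF step.prems(1), of X] agree_flip[OF step.prems(3), of X]
    unfolding agree_def by simp
  obtain m As Xs where IH: "As 0 = Inv A X" "As m = B" "\<forall>k\<le>m. gen_tournament n (As k)"
      "\<forall>k<m. is_clan n (As k) (Xs k) \<and> As (Suc k) = Inv (As k) (Xs k)"
    using step.IH[OF gen_tournament_Inv[OF step.prems(1)] step.prems(2) ag step.prems(4)]
    by (elim exE conjE) (rule that)
  \<comment> \<open>\<open>case_nat\<close> prepends the first matrix and its clan, shifting the
    sequence from the induction hypothesis by one.\<close>
  define As' where "As' = case_nat A As"
  define Xs' where "Xs' = case_nat X Xs"
  have "As' 0 = A" "As' (Suc m) = B" unfolding As'_def using IH by auto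
  moreover have "gen_tournament n (As' k)" if "k \<le> Suc m" for k
    using that IH(3) step.prems(1) unfolding As'_def by (cases k) auto
  moreover have "is_clan n (As' k) (Xs' k) \<and> As' (Suc k) = Inv (As' k) (Xs' k)" if "k < Suc m" for k
    using that IH(1,4) clan unfolding As'_def Xs'_def by (cases k) auto
  ultimately show ?case
    by (intro exI[of _ "Suc m"] exI[of _ As'] exI[of _ Xs']) blast
qed

lemma minors_eq_if_clan_sequence:
  fixes As :: "nat \<Rightarrow> real mat"
  assumes "\<forall>k\<le>m. gen_tournament n (As k)" "Y \<subseteq> {..<n}"
    and "\<forall>k<m. is_clan n (As k) (Xs k) \<and> As (Suc k) = Inv (As k) (Xs k)"
  shows "det (principal_submatrix (As 0) Y) = det (principal_submatrix (As m) Y)"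
  using assms
proof (induction m)
  case (Suc m)
  have "As m \<in> carrier_mat n n" using Suc.prems(1) unfolding gen_tournament_def by simp
  then have "det (principal_submatrix (As (Suc m)) Y) = det (principal_submatrix (As m) Y)"
    using det_principal_submatrix_Inv[of "As m" n "Xs m" Y] Suc.prems(2,3) by simp
  then show ?case using Suc by simp
qed simp

theorem theorem2p4:
  fixes n :: nat and A B :: "real mat"
  assumes "n \<ge> 1"
    and "gen_tournament n A" and "gen_tournament n B"
  shows "((\<forall>X. X \<subseteq> {..<n} \<and> 1 \<le> card X \<and> card X \<le> 4 \<longrightarrow>
              det (principal_submatrix A X) = det (principal_submatrix B X))
          \<longleftrightarrow>
          (\<forall>X. X \<subseteq> {..<n} \<and> X \<noteq> {} \<longrightarrow>
              det (principal_submatrix A X) = det (principal_submatrix B X)))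
       \<and>
         ((\<forall>X. X \<subseteq> {..<n} \<and> X \<noteq> {} \<longrightarrow>
              det (principal_submatrix A X) = det (principal_submatrix B X))
          \<longleftrightarrow>
          (\<exists>(m::nat) (As :: nat \<Rightarrow> real mat) (Xs :: nat \<Rightarrow> nat set).
              As 0 = A \<and> As m = B \<and>
              (\<forall>k\<le>m. gen_tournament n (As k)) \<and>
              (\<forall>k<m. is_clan n (As k) (Xs k) \<and> As (Suc k) = Inv (As k) (Xs k))))"
    (is "(?i \<longleftrightarrow> ?ii) \<and> (?ii \<longleftrightarrow> ?iii)")
proof -
  \<comment> \<open>The three assertions are linked in a cycle; here a lower bound of 1 on the
    cardinality makes \<open>X\<close> nonempty.\<close>
  have "?ii \<Longrightarrow> ?i" by auto
  moreover have "?i \<Longrightarrow> ?iii"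
  proof -
    assume ?i
    then have "minors_agree {..<n} (skew_part A) (skew_part B)"
      by (rule minors_agree_if_small_minors_eq[OF assms(2,3)])
    then have "reach {..<n} (skew_part A) (skew_part B)"
      by (intro reach_if_minors_agree skew_skew_part) auto
    then show ?iii by (rule clan_sequence_if_reach[OF _ assms(2,3)]) (auto simp: agree_def)
  qed
  moreover have "?iii \<Longrightarrow> ?ii"
  proof (intro allI impI, elim exE conjE)
    fix X m As Xs
    assume X: "X \<subseteq> {..<n}" and As: "As 0 = A" "As m = B" "\<forall>k\<le>m. gen_tournament n (As k)"
      "\<forall>k<m. is_clan n (As k) (Xs k) \<and> As (Suc k) = Inv (As k) (Xs k)"
    show "det (principal_submatrix A X) = det (principal_submatrix B X)"
      using minors_eq_if_clan_sequence[OF As(3) X As(4)] As(1,2) by simp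
  qed
  ultimately show ?thesis by argo
qed

end
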